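(* Let $X$ be a (real or complex) Banach space such that $X^*$ is isometrically isomorphic to $\ell_1$, and let $Y$ be a Banach space of dimension at least two over the same field. If $Y$ is uniformly convex or, in the complex case, if $Y$ is $\mathbb C$-uniformly convex, then the subspace $\mathcal K(X,Y)$ has the BPBp-RSE.
   Context: $\mathbb K\in\{\mathbb R,\mathbb C\}$ is the scalar field; $B_X$, $S_X$ are the closed unit ball and unit sphere of $X$; $\mathbb T=\{\lambda\in\mathbb K:|\lambda|=1\}$; $\mathcal L(X,Y)$ and $\mathcal K(X,Y)$ are the spaces of bounded and of compact linear operators. An operator $T\in\mathcal L(X,Y)$ is range strongly exposing, $T\in\mathrm{RSE}(X,Y)$, if there is $x_0\in S_X$ such that whenever $(x_n)\subseteq B_X$ satisfies $\|Tx_n\|\to\|T\|$, there are a subsequence $(x_{\sigma(n)})$ and $\lambda\in\mathbb T$ with $Tx_{\sigma(n)}\to\lambda Tx_0$. A linear subspace $\mathcal M\subseteq\mathcal L(X,Y)$ has the BPBp-RSE if for every $\varepsilon>0$ there is $0<\eta(\varepsilon)<\varepsilon$ such that for every $T\in\mathcal M$ with $\|T\|=1$ and every $x\in S_X$ with $\|Tx\|>1-\eta(\varepsilon)$, there exist $S\in\mathrm{RSE}(X,Y)\cap\mathcal M$ and $x_0\in S_X$ with $\|S\|=\|Sx_0\|=1$, $\|S-T\|<\varepsilon$ and $\|x-x_0\|<\varepsilon$. $Y$ is uniformly convex if for every $\varepsilon>0$ there is $0<\delta<1$ such that $y_1,y_2\in S_Y$ and $\|y_1+y_2\|/2>1-\delta$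 imply $\|y_1-y_2\|<\varepsilon$. A complex Banach space $Y$ is $\mathbb C$-uniformly convex if for every $\varepsilon>0$ there is $\delta>0$ such that whenever $y_0,y_1\in Y$ satisfy $\|y_0+wy_1\|\le 1$ for every $w\in\mathbb T$ and $\|y_1\|>\varepsilon$, one has $\|y_0\|<1-\delta$. *)

theory Defs
  imports "HOL-Analysis.Analysis"
begin

text \<open>
  A normed space over \<open>'k\<close> (here always \<open>real\<close> or \<open>complex\<close>) is a type of class
  \<open>real_normed_vector\<close> together with a scalar multiplication by \<open>'k\<close> that extends the
  given real one; completeness is class \<open>banach\<close>. For \<open>'k = real\<close> the multiplication is
  necessarily \<open>scaleR\<close>.
\<close>

locale normed_space_over = vector_space scale
  for scale :: "'k::real_normed_field \<Rightarrow> 'a::real_normed_vector \<Rightarrow> 'a" +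
  assumes scale_of_real: "scale (of_real r) x = r *\<^sub>R x"
    and norm_scale: "norm (scale c x) = norm c * norm x"

text \<open>
  \<open>\<L>(X,Y)\<close>: the \<open>'k\<close>-linear elements of the type of real-linear bounded operators.
  The norm of that type is the usual operator norm.
\<close>

definition bounded_operators ::
  "('k::real_normed_field \<Rightarrow> 'a::real_normed_vector \<Rightarrow> 'a) \<Rightarrow>
   ('k \<Rightarrow> 'b::real_normed_vector \<Rightarrow> 'b) \<Rightarrow> ('a \<Rightarrow>\<^sub>L 'b) set" where
  "bounded_operators sX sY = {T. Vector_Spaces.linear sX sY (blinfun_apply T)}"

definition compact_operators ::
  "('k::real_normed_field \<Rightarrow> 'a::real_normed_vector \<Rightarrow> 'a) \<Rightarrow>
   ('k \<Rightarrow> 'b::real_normed_vector \<Rightarrow> 'b) \<Rightarrow> ('a \<Rightarrow>\<^sub>L 'b) set" where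
  "compact_operators sX sY =
    {T \<in> bounded_operators sX sY. compact (closure (blinfun_apply T ` cball 0 1))}"

definition ell1 :: "(nat \<Rightarrow> 'k::real_normed_field) set" where
  "ell1 = {a. summable (\<lambda>n. norm (a n))}"

text \<open>\<open>X\<^sup>*\<close> is \<open>bounded_operators sX (*)\<close>.\<close>

definition dual_isometric_ell1 ::
  "('k::real_normed_field \<Rightarrow> 'a::real_normed_vector \<Rightarrow> 'a) \<Rightarrow> bool" where
  "dual_isometric_ell1 sX \<longleftrightarrow>
    (\<exists>\<Phi> :: (nat \<Rightarrow> 'k) \<Rightarrow> ('a \<Rightarrow>\<^sub>L 'k).
      bij_betw \<Phi> ell1 (bounded_operators sX (*)) \<and>
      (\<forall>a\<in>ell1. \<forall>b\<in>ell1. \<Phi> (\<lambda>n. a n + b n) = \<Phi> a + \<Phi> b) \<and>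
      (\<forall>c. \<forall>a\<in>ell1. \<forall>x. blinfun_apply (\<Phi> (\<lambda>n. c * a n)) x = c * blinfun_apply (\<Phi> a) x) \<and>
      (\<forall>a\<in>ell1. norm (\<Phi> a) = (\<Sum>n. norm (a n))))"

definition RSE ::
  "('k::real_normed_field \<Rightarrow> 'a::real_normed_vector \<Rightarrow> 'a) \<Rightarrow>
   ('k \<Rightarrow> 'b::real_normed_vector \<Rightarrow> 'b) \<Rightarrow> ('a \<Rightarrow>\<^sub>L 'b) set" where
  "RSE sX sY =
    {T \<in> bounded_operators sX sY.
      \<exists>x0\<in>sphere 0 1. \<forall>x :: nat \<Rightarrow> 'a.
        (\<forall>n. x n \<in> cball 0 1) \<and> (\<lambda>n. norm (blinfun_apply T (x n))) \<longlonglongrightarrow> norm T \<longrightarrow>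
        (\<exists>\<sigma> :: nat \<Rightarrow> nat. \<exists>l :: 'k. strict_mono \<sigma> \<and> norm l = 1 \<and>
          (\<lambda>n. blinfun_apply T (x (\<sigma> n))) \<longlonglongrightarrow> sY l (blinfun_apply T x0))}"

text \<open>Meant for linear subspaces \<open>M\<close> of \<open>bounded_operators sX sY\<close>.\<close>

definition has_BPBp_RSE ::
  "('k::real_normed_field \<Rightarrow> 'a::real_normed_vector \<Rightarrow> 'a) \<Rightarrow>
   ('k \<Rightarrow> 'b::real_normed_vector \<Rightarrow> 'b) \<Rightarrow> ('a \<Rightarrow>\<^sub>L 'b) set \<Rightarrow> bool" where
  "has_BPBp_RSE sX sY M \<longleftrightarrow>
    (\<forall>\<epsilon>>0. \<exists>\<eta>. 0 < \<eta> \<and> \<eta> < \<epsilon> \<and>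
      (\<forall>T\<in>M. \<forall>x\<in>sphere 0 1. norm T = 1 \<and> norm (blinfun_apply T x) > 1 - \<eta> \<longrightarrow>
        (\<exists>S\<in>RSE sX sY \<inter> M. \<exists>x0\<in>sphere 0 1.
          norm S = 1 \<and> norm (blinfun_apply S x0) = 1 \<and>
          norm (S - T) < \<epsilon> \<and> norm (x - x0) < \<epsilon>)))"

definition uniformly_convex :: "'b::real_normed_vector itself \<Rightarrow> bool" where
  "uniformly_convex _ \<longleftrightarrow>
    (\<forall>\<epsilon>>0. \<exists>\<delta>. 0 < \<delta> \<and> \<delta> < 1 \<and>
      (\<forall>y1\<in>sphere (0::'b) 1. \<forall>y2\<in>sphere 0 1.
        norm (y1 + y2) / 2 > 1 - \<delta> \<longrightarrow> norm (y1 - y2) < \<epsilon>))"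

definition complex_uniformly_convex ::
  "(complex \<Rightarrow> 'b::real_normed_vector \<Rightarrow> 'b) \<Rightarrow> bool" where
  "complex_uniformly_convex sY \<longleftrightarrow>
    (\<forall>\<epsilon>>0. \<exists>\<delta>>0. \<forall>y0 y1.
      (\<forall>w. norm w = 1 \<longrightarrow> norm (y0 + sY w y1) \<le> 1) \<and> norm y1 > \<epsilon> \<longrightarrow> norm y0 < 1 - \<delta>)"

text \<open>
  Stated by a linearly independent pair because the library's \<open>dim\<close> does not treat
  infinite-dimensional spaces as having large dimension.
\<close>

definition dimension_at_least_two ::
  "('k::real_normed_field \<Rightarrow> 'b::real_normed_vector \<Rightarrow> 'b) \<Rightarrow> bool" where
  "dimension_at_least_two sY \<longleftrightarrow>
    (\<exists>y1 y2. y1 \<noteq> y2 \<and> \<not> module.dependent sY {y1, y2})"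

end

theory Submission imports Defs begin

text \<open>
  Let \<open>\<phi>\<^sub>n\<close> be the functionals on \<open>X\<close> that correspond to the unit vectors of \<open>\<ell>\<^sub>1\<close>. Every
  functional on \<open>X\<close> is an absolutely convergent combination of them, so points of \<open>X\<close> are
  determined by the bounded sequences \<open>(\<phi>\<^sub>n x)\<^sub>n\<close> of their coordinates. For the points of the unit
  ball of \<open>X\<close> these sequences are dense in the unit ball of \<open>\<ell>\<^sub>\<infinity>\<close> with respect to coordinatewise
  convergence (\<open>ball_coord_sequence\<close>). Two consequences reduce the
  theorem to finitely many coordinates. A compact \<open>T\<close> is close in norm to an operator
  \<open>x \<mapsto> \<Sum>i<N. \<phi>\<^sub>i x y\<^sub>i\<close>, where \<open>y\<^sub>i\<close> is the value at the \<open>i\<close>-th unit vector of the extension of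
  \<open>T\<close> to \<open>\<ell>\<^sub>\<infinity>\<close> (\<open>compact_operator_finite_coords\<close>). And if finitely many coordinates of some \<open>x\<close>
  in the ball are close to prescribed scalars of modulus at most one, then a nearby point of the
  ball has exactly these coordinates (\<open>move_coords_exactly\<close>).

  It remains to perturb \<open>V w = \<Sum>i\<in>F. w\<^sub>i y\<^sub>i\<close>, a contraction on bounded scalar sequences, that
  almost attains its norm at \<open>x\<close>. Uniform convexity is used only in the form: if
  \<open>norm (y\<^sub>0 + c y\<^sub>1) \<le> 1\<close> for all scalars \<open>c\<close> of modulus one and \<open>y\<^sub>0\<close> is almost a unit vector,
  then \<open>y\<^sub>1\<close> is small. It shows that \<open>V\<close> is small on the coordinates where the modulus of \<open>x\<close> is
  not close to one; on the set \<open>A\<close> of the other coordinates \<open>x\<close> is close to a unimodular sequence,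
  which a rotation of the \<open>y\<^sub>i\<close> turns into the constant \<open>1\<close>. Let \<open>u = V 1\<close>, let \<open>g\<close> be a functional that norms \<open>u\<close>,
  and put \<open>a\<^sub>i = g y\<^sub>i\<close>. The operator \<open>V\<^sub>1 w = V w + \<kappa> (\<Sum>i\<in>A. a\<^sub>i w\<^sub>i) u\<close> attains its norm at some
  \<open>w\<close>, and the extra term forces \<open>w\<^sub>i\<close> to be close to \<open>1\<close> off a set \<open>B\<close> on which \<open>\<bar>a\<^sub>i\<bar>\<close> has
  small sum. Uniform convexity makes \<open>V\<close> small on \<open>B\<close>. Hence \<open>V\<^sub>2 v = V\<^sub>1 (v w)\<close>, with the
  coordinatewise product, is close to \<open>V\<close>, and it attains its norm at the constant \<open>1\<close>
  (\<open>perturb_to_attain_at_one\<close>). Adding a small multiple of \<open>v \<mapsto> (average of v on A) V\<^sub>2 1\<close> makes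
  the sequences that are constant and unimodular on \<open>A\<close> the only points where the norm is attained
  (\<open>perturb_to_peak_at_one\<close>). Since the ball of \<open>\<ell>\<^sub>\<infinity>\<close> is coordinatewise compact, this uniqueness
  gives the subsequences in the definition of a range strongly exposing operator
  (\<open>coord_operator_RSE\<close>).

  Real and complex scalars are treated together: the scalars form a type that is a normed field
  and a Euclidean space, and \<open>z \<bullet> 1\<close> is the real part of \<open>z\<close>.
\<close>

section \<open>Separation by sublinear functionals\<close>

definition sublinear :: "('v::real_vector \<Rightarrow> real) \<Rightarrow> bool" where
  "sublinear p \<longleftrightarrow> (\<forall>x y. p (x + y) \<le> p x + p y) \<and> (\<forall>t x. 0 \<le> t \<longrightarrow> p (t *\<^sub>R x) = t * p x)"

lemma sublinear_zero: "sublinear p \<Longrightarrow> p 0 = 0"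
  unfolding sublinear_def by (metis mult_zero_left order_refl scaleR_zero_left)

lemma sublinear_neg: "sublinear p \<Longrightarrow> - p (- x) \<le> p x"
  using sublinear_zero[of p] unfolding sublinear_def
  by (metis add.right_inverse le_add_same_cancel2 minus_le_iff neg_le_iff_le diff_0 diff_le_eq)

text \<open>
  The functional \<open>q x = inf {p (x + t c) - t m | t \<ge> 0, c \<in> C}\<close> lies below \<open>p\<close>, and every linear
  \<open>f \<le> q\<close> satisfies \<open>f \<ge> m\<close> on \<open>C\<close>, since \<open>f c = - f (- c) \<ge> - q (- c)\<close>. So the bound on a convex
  set is encoded in a smaller sublinear functional, and separation theorems follow from the
  existence of linear minorants. Convexity of \<open>C\<close> is what makes \<open>q\<close> subadditive.
\<close>

lemma sublinear_push_down:
  fixes p :: "'v::real_vector \<Rightarrow> real"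
  assumes p: "sublinear p" and C: "convex C" "C \<noteq> {}" and m: "\<And>c. c \<in> C \<Longrightarrow> m \<le> p c"
  obtains q where "sublinear q" "\<And>x. q x \<le> p x" "\<And>c. c \<in> C \<Longrightarrow> q (- c) \<le> - m"
proof -
  define D where "D x = {p (x + t *\<^sub>R c) - t * m |t c. 0 \<le> t \<and> c \<in> C}" for x
  define q where "q x = Inf (D x)" for x
  have padd: "p (x + y) \<le> p x + p y" and pscale: "0 \<le> t \<Longrightarrow> p (t *\<^sub>R x) = t * p x" for x y t
    using p unfolding sublinear_def by auto
  have low: "- p (- x) \<le> d" if dD: "d \<in> D x" for d x
  proof -
    obtain t c where t: "0 \<le> t" "c \<in> C" and d: "d = p (x + t *\<^sub>R c) - t * m"
      using dD unfolding D_def by auto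
    have "t * m \<le> t * p c" using m t by (simp add: mult_left_mono)
    also have "\<dots> = p ((x + t *\<^sub>R c) + (- x))" using pscale t by simp
    also have "\<dots> \<le> p (x + t *\<^sub>R c) + p (- x)" by (rule padd)
    finally show ?thesis using d by simp
  qed
  have bdd: "bdd_below (D x)" for x using low by (meson bdd_belowI)
  obtain c0 where c0: "c0 \<in> C" using C by auto
  have mem: "p (x + t *\<^sub>R c) - t * m \<in> D x" if "0 \<le> t" "c \<in> C" for x t c
    using that unfolding D_def by auto
  have ne: "D x \<noteq> {}" for x using mem[of 0 c0 x] c0 by auto
  have ub: "q x \<le> p (x + t *\<^sub>R c) - t * m" if "0 \<le> t" "c \<in> C" for x t c
    unfolding q_def by (rule cInf_lower[OF mem[OF that] bdd])
  have qadd: "q (x + y) \<le> q x + q y" for x y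
  proof -
    have key: "q (x + y) \<le> d + e" if dD: "d \<in> D x" and eD: "e \<in> D y" for d e
    proof -
      obtain t c where t: "0 \<le> t" "c \<in> C" and d: "d = p (x + t *\<^sub>R c) - t * m"
        using dD unfolding D_def by auto
      obtain s b where s: "0 \<le> s" "b \<in> C" and e: "e = p (y + s *\<^sub>R b) - s * m"
        using eD unfolding D_def by auto
      obtain a where a: "a \<in> C" "(t + s) *\<^sub>R a = t *\<^sub>R c + s *\<^sub>R b"
      proof (cases "t + s = 0")
        case True
        then have "t = 0" "s = 0" using t s by auto
        then show thesis using that c0 by auto
      next
        case False
        then have "(t / (t+s)) *\<^sub>R c + (s / (t+s)) *\<^sub>R b \<in> C"
          using C(1) t s False by (intro convexD) (auto simp flip: add_divide_distrib)
        moreover have "(t + s) *\<^sub>R ((t / (t+s)) *\<^sub>R c + (s / (t+s)) *\<^sub>R b) = t *\<^sub>R c + s *\<^sub>R b"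
          using False by (simp add: scaleR_add_right)
        ultimately show thesis using that by blast
      qed
      have "q (x + y) \<le> p ((x + y) + (t + s) *\<^sub>R a) - (t + s) * m"
        by (rule ub) (use t s a in auto)
      also have "(x + y) + (t + s) *\<^sub>R a = (x + t *\<^sub>R c) + (y + s *\<^sub>R b)" using a by simp
      also have "p \<dots> \<le> p (x + t *\<^sub>R c) + p (y + s *\<^sub>R b)" by (rule padd)
      finally show ?thesis using d e by (simp add: algebra_simps)
    qed
    have "q (x + y) - d \<le> q y" if "d \<in> D x" for d
      unfolding q_def[of y] by (rule cInf_greatest[OF ne]) (use key[OF that] in force)
    then have "q (x + y) - q y \<le> q x"
      unfolding q_def[of x] by (intro cInf_greatest[OF ne]) force
    then show ?thesis by simp
  qed
  have qscale_le: "q (r *\<^sub>R x) \<le> r * q x" if "0 < r" for r x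
  proof -
    have "q (r *\<^sub>R x) / r \<le> d" if dD: "d \<in> D x" for d
    proof -
      obtain t c where t: "0 \<le> t" "c \<in> C" and d: "d = p (x + t *\<^sub>R c) - t * m"
        using dD unfolding D_def by auto
      have "q (r *\<^sub>R x) \<le> p (r *\<^sub>R x + (r * t) *\<^sub>R c) - (r * t) * m"
        by (rule ub) (use t \<open>0 < r\<close> in auto)
      also have "r *\<^sub>R x + (r * t) *\<^sub>R c = r *\<^sub>R (x + t *\<^sub>R c)" by (simp add: scaleR_add_right)
      also have "p (r *\<^sub>R (x + t *\<^sub>R c)) = r * p (x + t *\<^sub>R c)"
        using \<open>0 < r\<close> by (intro pscale) simp
      finally have "q (r *\<^sub>R x) \<le> r * d" using d by (simp add: right_diff_distrib mult.assoc)
      then show ?thesis using \<open>0 < r\<close> by (simp add: field_simps)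
    qed
    then have "q (r *\<^sub>R x) / r \<le> q x"
      unfolding q_def[of x] by (intro cInf_greatest[OF ne])
    then show ?thesis using \<open>0 < r\<close> by (simp add: field_simps)
  qed
  have qp: "q x \<le> p x" for x using ub[of 0 c0 x] c0 by simp
  have "q 0 = 0"
  proof -
    have "0 \<le> q 0" unfolding q_def
      by (rule cInf_greatest[OF ne]) (use low[of _ 0] sublinear_zero[OF p] in force)
    then show ?thesis using qp[of 0] sublinear_zero[OF p] by simp
  qed
  moreover have "q (r *\<^sub>R x) = r * q x" if "0 < r" for r x
  proof (rule antisym[OF qscale_le[OF that]])
    have "q (inverse r *\<^sub>R (r *\<^sub>R x)) \<le> inverse r * q (r *\<^sub>R x)"
      by (rule qscale_le) (use that in simp)
    then show "r * q x \<le> q (r *\<^sub>R x)" using that by (simp add: field_simps)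
  qed
  ultimately have "sublinear q" unfolding sublinear_def using qadd
    by (metis less_eq_real_def mult_zero_left scaleR_zero_left)
  moreover have "q (- c) \<le> - m" if "c \<in> C" for c
    using ub[of 1 c "- c"] that sublinear_zero[OF p] by simp
  ultimately show thesis using qp that by blast
qed

text \<open>
  The Hahn-Banach theorem in the form that a minimal sublinear functional is linear: lowering a
  minimal \<open>f\<close> in the direction \<open>c\<close> by \<open>sublinear_push_down\<close> changes nothing, which forces
  \<open>f (- c) \<le> - f c\<close>. Minimal elements exist by Zorn's lemma, since pointwise infima of chains are
  sublinear.
\<close>

lemma sublinear_dominates_linear:
  fixes p :: "'v::real_vector \<Rightarrow> real"
  assumes p: "sublinear p"
  obtains f where "linear f" "\<And>x. f x \<le> p x"
proof -
  define A where "A = {q. sublinear q \<and> (\<forall>x. q x \<le> p x)}"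
  define P where "P a b \<longleftrightarrow> (\<forall>x. b x \<le> a x)" for a b :: "'v \<Rightarrow> real"
  have "\<exists>m\<in>A. \<forall>a\<in>A. P m a \<longrightarrow> a = m"
  proof (rule predicate_Zorn)
    show "partial_order_on A (relation_of P A)"
      by (rule partial_order_on_relation_ofI)
        (auto simp: P_def fun_eq_iff intro: order_trans antisym)
    fix C assume C: "C \<in> Chains (relation_of P A)"
    show "\<exists>u\<in>A. \<forall>a\<in>C. P a u"
    proof (cases "C = {}")
      case True
      then show ?thesis using p unfolding A_def by auto
    next
      case False
      have CA: "c \<in> A" if "c \<in> C" for c
        using C that unfolding Chains_def relation_of_def by auto
      have comp: "P a b \<or> P b a" if "a \<in> C" "b \<in> C" for a b
        using C that unfolding Chains_def relation_of_def by auto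
      define u where "u x = Inf ((\<lambda>q. q x) ` C)" for x
      have low: "- p (- x) \<le> q x" if "q \<in> C" for q x
        using CA[OF that] sublinear_neg[of q x] unfolding A_def
        by (smt (verit, best) mem_Collect_eq)
      have bdd: "bdd_below ((\<lambda>q. q x) ` C)" for x using low by (auto intro!: bdd_belowI)
      have ub: "u x \<le> q x" if "q \<in> C" for q x
        unfolding u_def by (rule cInf_lower) (use that bdd in auto)
      have gr: "l \<le> u x" if "\<And>q. q \<in> C \<Longrightarrow> l \<le> q x" for l x
        unfolding u_def by (rule cInf_greatest) (use False that in auto)
      have "u (x + y) \<le> u x + u y" for x y
      proof -
        have key: "u (x + y) \<le> q x + r y" if qr: "q \<in> C" "r \<in> C" for q r
        proof -
          obtain s where s: "s \<in> C" "s x \<le> q x" "s y \<le> r y"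
            using comp[OF qr] qr unfolding P_def by (metis order_refl)
          have "u (x + y) \<le> s (x + y)" using ub s by blast
          also have "\<dots> \<le> s x + s y" using CA[OF s(1)] unfolding A_def sublinear_def by auto
          finally show ?thesis using s by simp
        qed
        have "u (x + y) - q x \<le> u y" if "q \<in> C" for q
          by (rule gr) (use key[OF that] in force)
        then have "u (x + y) - u y \<le> u x" by (intro gr) force
        then show ?thesis by simp
      qed
      moreover have "u (t *\<^sub>R x) = t * u x" if "0 \<le> t" for t x
      proof -
        have eq: "q (t *\<^sub>R x) = t * q x" if "q \<in> C" for q
          using CA[OF that] \<open>0 \<le> t\<close> unfolding A_def sublinear_def by auto
        show ?thesis
        proof (cases "t = 0")
          case True
          then show ?thesis using eq False ub[of _ 0] gr[of 0 0]
            by (metis (no_types, lifting) antisym ex_in_conv mult_zero_left order_refl scaleR_zero_left)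
        next
          case t: False
          then have "0 < t" using that by simp
          have "u (t *\<^sub>R x) / t \<le> u x"
            by (rule gr) (use ub[of _ "t *\<^sub>R x"] eq \<open>0 < t\<close> in \<open>force simp: field_simps\<close>)
          moreover have "t * u x \<le> u (t *\<^sub>R x)"
            by (rule gr) (simp add: eq ub \<open>0 < t\<close>)
          ultimately show ?thesis using \<open>0 < t\<close> by (simp add: field_simps)
        qed
      qed
      ultimately have "sublinear u" unfolding sublinear_def by blast
      moreover have "u x \<le> p x" for x
        using False ub CA unfolding A_def by (metis (mono_tags, lifting) ex_in_conv mem_Collect_eq order_trans)
      ultimately have "u \<in> A" unfolding A_def by blast
      then show ?thesis using ub unfolding P_def by blast
    qed
  qed
  then obtain f where fA: "f \<in> A" and min: "\<And>a. a \<in> A \<Longrightarrow> P f a \<Longrightarrow> a = f" by blast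
  have f: "sublinear f" "\<And>x. f x \<le> p x" using fA unfolding A_def by auto
  have odd: "f (- c) = - f c" for c
  proof -
    obtain q where q: "sublinear q" "\<And>x. q x \<le> f x" "\<And>b. b \<in> {c} \<Longrightarrow> q (- b) \<le> - f c"
      by (rule sublinear_push_down[OF f(1), of "{c}" "f c"]) auto
    have "q = f" using q f by (intro min) (auto simp: A_def P_def intro: order_trans)
    then show ?thesis using q(3)[of c] sublinear_neg[OF f(1), of "- c"] by simp
  qed
  have add: "f (x + y) \<le> f x + f y" and scale: "0 \<le> t \<Longrightarrow> f (t *\<^sub>R x) = t * f x" for x y t
    using f(1) unfolding sublinear_def by auto
  have "linear f"
  proof (rule linearI)
    fix x y show "f (x + y) = f x + f y"
      using add[of x y] add[of "- x" "- y"] odd[of x] odd[of y] odd[of "x + y"] by simp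
  next
    fix t x show "f (t *\<^sub>R x) = t *\<^sub>R f x"
    proof (cases "0 \<le> t")
      case False
      then have "f ((- t) *\<^sub>R x) = (- t) * f x" by (intro scale) simp
      then show ?thesis using odd[of "t *\<^sub>R x"] by simp
    qed (simp add: scale)
  qed
  then show thesis using f that by blast
qed

lemma norm_separation:
  fixes C :: "'v::real_normed_vector set"
  assumes C: "convex C" "C \<noteq> {}" and m: "\<And>c. c \<in> C \<Longrightarrow> m \<le> norm c"
  obtains f where "linear f" "\<And>x. f x \<le> norm x" "\<And>c. c \<in> C \<Longrightarrow> m \<le> f c"
proof -
  have "sublinear (norm :: 'v \<Rightarrow> real)"
    unfolding sublinear_def by (simp add: norm_triangle_ineq)
  then obtain q where q: "sublinear q" "\<And>x. q x \<le> norm x" "\<And>c. c \<in> C \<Longrightarrow> q (- c) \<le> - m"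
    using sublinear_push_down[of norm C m] C m by blast
  obtain f where f: "linear f" "\<And>x. f x \<le> q x" using sublinear_dominates_linear[OF q(1)] by blast
  have "m \<le> f c" if "c \<in> C" for c
    using f(2)[of "- c"] q(3)[OF that] linear_neg[OF f(1), of c] by simp
  then show thesis using that f q by (meson order_trans)
qed

section \<open>Functionals over the real or complex scalars\<close>

text \<open>
  Conjugation, expressed through the field operations so that it makes sense for both
  scalar fields; at zero the value is zero because \<open>inverse 0 = 0\<close>.
\<close>

definition cj :: "'k::{real_normed_field,euclidean_space} \<Rightarrow> 'k" where
  "cj z = of_real ((norm z)\<^sup>2) * inverse z"

lemma norm_cj [simp]: "norm (cj z) = norm z"
  by (cases "z = 0") (simp_all add: cj_def norm_mult norm_inverse power2_eq_square)

lemma cj_mult_self: "cj z * z = of_real ((norm z)\<^sup>2)"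
  by (cases "z = 0") (simp_all add: cj_def)

lemma inner_unimodular:
  fixes u a b :: "'k::{real_normed_field,euclidean_space}"
  assumes "norm u = 1"
  shows "(u * a) \<bullet> (u * b) = a \<bullet> b"
  using assms by (simp add: dot_norm norm_mult flip: distrib_left)

text \<open>
  Multiplication by a unimodular scalar preserves the inner product, so division by the
  unimodular part of \<open>r\<close> moves that factor to the other side as its conjugate.
\<close>

lemma inner_eq_cj:
  fixes r c :: "'k::{real_normed_field,euclidean_space}"
  shows "r \<bullet> c = (cj r * c) \<bullet> 1"
proof (cases "r = 0")
  case False
  define u where "u = r / of_real (norm r)"
  have u: "norm u = 1" "norm (inverse u) = 1" "u \<noteq> 0"
    using False by (auto simp: u_def norm_divide norm_inverse)
  have r: "r = norm r *\<^sub>R u" using False by (simp add: u_def scaleR_conv_of_real)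
  have "r \<bullet> c = norm r * (u \<bullet> c)" by (subst r) simp
  also have "u \<bullet> c = (inverse u * u) \<bullet> (inverse u * c)" by (rule inner_unimodular[OF u(2), symmetric])
  also have "\<dots> = (inverse u * c) \<bullet> 1" using u(3) by (simp add: inner_commute)
  also have "norm r * \<dots> = (norm r *\<^sub>R (inverse u * c)) \<bullet> 1" by simp
  also have "norm r *\<^sub>R (inverse u * c) = cj r * c"
    using False by (simp add: u_def cj_def scaleR_conv_of_real power2_eq_square field_simps)
  finally show ?thesis .
qed (simp add: cj_def)

lemma inner_one_le_norm: "z \<bullet> 1 \<le> norm z" for z :: "'k::{real_normed_field,euclidean_space}"
  using norm_cauchy_schwarz[of z 1] by simp

lemma of_real_inner_one [simp]: "of_real r \<bullet> (1::'k::{real_normed_field,euclidean_space}) = r"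
  by (simp add: of_real_def) (metis norm_one norm_eq_1)

lemma rotate_to_norm:
  fixes z :: "'k::{real_normed_field,euclidean_space}"
  obtains l where "norm l = 1" "l * z = of_real (norm z)"
proof (cases "z = 0")
  case False
  then show thesis by (intro that[of "of_real (norm z) / z"]) (auto simp: norm_divide)
qed (use that[of 1] in simp)

context normed_space_over
begin

lemma bounded_linear_scale_left: "bounded_linear (\<lambda>c. scale c x)"
proof (rule bounded_linear_intro[of _ "norm x"])
  show "scale (r *\<^sub>R c) x = r *\<^sub>R scale c x" for r c
    using scale_scale[of "of_real r" c x] by (simp only: scale_of_real scaleR_conv_of_real)
qed (auto simp: scale_left_distrib norm_scale)

lemma bounded_linear_scale_right: "bounded_linear (\<lambda>x. scale c x)"
proof (rule bounded_linear_intro[of _ "norm c"])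
  show "scale c (r *\<^sub>R x) = r *\<^sub>R scale c x" for r x
    using scale_left_commute[of c "of_real r" x] by (simp only: scale_of_real)
qed (auto simp: scale_right_distrib norm_scale)

lemma tendsto_scale:
  assumes "(f \<longlongrightarrow> a) F"
  shows "((\<lambda>n. scale (f n) x) \<longlongrightarrow> scale a x) F"
  by (rule bounded_linear.tendsto[OF bounded_linear_scale_left assms])

end

lemma mem_dual_iff:
  fixes sX :: "'k::real_normed_field \<Rightarrow> 'a::real_normed_vector \<Rightarrow> 'a"
  assumes "normed_space_over sX"
  shows "g \<in> bounded_operators sX (*) \<longleftrightarrow> (\<forall>c x. blinfun_apply g (sX c x) = c * blinfun_apply g x)"
proof -
  interpret normed_space_over sX by fact
  have "vector_space ((*) :: 'k \<Rightarrow> 'k \<Rightarrow> 'k)"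
    by unfold_locales (auto simp: algebra_simps)
  then show ?thesis
    using vector_space_axioms
    unfolding bounded_operators_def Vector_Spaces.linear_iff by (simp add: blinfun.add_right)
qed

text \<open>
  For fixed \<open>x\<close> the map \<open>c \<mapsto> f (c x)\<close> is real linear on the scalars, hence an inner product with
  a vector; the conjugate of that vector is the value at \<open>x\<close> of the unique scalar-linear functional
  with real part \<open>f\<close>. Rotating \<open>x\<close> shows that the norm does not grow.
\<close>

lemma functional_over_scalar_field:
  fixes sX :: "'k::{real_normed_field,euclidean_space} \<Rightarrow> 'a::real_normed_vector \<Rightarrow> 'a"
  assumes "normed_space_over sX" and f: "linear f" "\<And>x. f x \<le> norm x"
  obtains g where "g \<in> bounded_operators sX (*)" "norm g \<le> 1"
    "\<And>x. blinfun_apply g x \<bullet> 1 = f x"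
proof -
  interpret normed_space_over sX by fact
  define w where "w x = (\<Sum>b\<in>Basis. f (sX b x) *\<^sub>R b)" for x
  define g where "g x = cj (w x)" for x
  have lin: "linear (\<lambda>c. f (sX c x))" for x
    using linear_compose[OF bounded_linear.linear[OF bounded_linear_scale_left] f(1)] by (simp add: o_def)
  have w: "w x \<bullet> c = f (sX c x)" for x c
  proof -
    have "f (sX c x) = f (sX (\<Sum>b\<in>Basis. (c \<bullet> b) *\<^sub>R b) x)" by (simp add: euclidean_representation)
    also have "\<dots> = (\<Sum>b\<in>Basis. (c \<bullet> b) * f (sX b x))"
      by (simp only: linear_sum[OF lin] linear_scale[OF lin] real_scaleR_def)
    finally show ?thesis unfolding w_def by (simp add: inner_sum_right mult.commute inner_commute)
  qed
  have g: "(c * g x) \<bullet> 1 = f (sX c x)" for c x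
    using w[of x c] inner_eq_cj[of "w x" c] by (simp add: g_def mult.commute)
  have uniq: "a = b" if "\<And>c. (c * a) \<bullet> 1 = (c * b) \<bullet> 1" for a b :: 'k
  proof -
    have "(cj (a - b) * (a - b)) \<bullet> 1 = 0" using that[of "cj (a - b)"] by (simp add: algebra_simps inner_diff_left)
    then show ?thesis by (simp add: cj_mult_self del: of_real_power)
  qed
  have gadd: "g (x + y) = g x + g y" for x y
    by (rule uniq) (simp add: g scale_right_distrib linear_add[OF f(1)] distrib_left inner_add_left)
  have gscale: "g (sX d x) = d * g x" for d x
    by (rule uniq) (simp add: g flip: mult.assoc)
  have gnorm: "norm (g x) \<le> norm x" for x
  proof -
    obtain l where l: "norm l = 1" "l * g x = of_real (norm (g x))" by (rule rotate_to_norm)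
    have "norm (g x) = f (sX l x)" using g[of l x] l by simp
    also have "\<dots> \<le> norm x" using f(2)[of "sX l x"] l by (simp add: norm_scale)
    finally show ?thesis .
  qed
  have bl: "bounded_linear g"
    by (rule bounded_linear_intro[of _ 1])
      (use gadd gnorm gscale[of "of_real r" for r] in \<open>auto simp: scale_of_real scaleR_conv_of_real\<close>)
  have ap: "blinfun_apply (Blinfun g) = g" by (rule bounded_linear_Blinfun_apply[OF bl])
  show thesis
  proof (rule that[of "Blinfun g"])
    show "Blinfun g \<in> bounded_operators sX (*)" using assms(1) by (simp add: mem_dual_iff ap gscale)
    show "norm (Blinfun g) \<le> 1" by (rule norm_blinfun_bound) (auto simp: ap gnorm)
    show "blinfun_apply (Blinfun g) x \<bullet> 1 = f x" for x using g[of 1 x] by (simp add: ap)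
  qed
qed

lemma norm_separation_over:
  fixes sX :: "'k::{real_normed_field,euclidean_space} \<Rightarrow> 'a::real_normed_vector \<Rightarrow> 'a"
  assumes "normed_space_over sX" "convex C" "C \<noteq> {}" "\<And>c. c \<in> C \<Longrightarrow> m \<le> norm c"
  obtains g where "g \<in> bounded_operators sX (*)" "norm g \<le> 1"
    "\<And>c. c \<in> C \<Longrightarrow> m \<le> blinfun_apply g c \<bullet> 1"
proof -
  obtain f where f: "linear f" "\<And>x. f x \<le> norm x" "\<And>c. c \<in> C \<Longrightarrow> m \<le> f c"
    using norm_separation[OF assms(2-4)] by blast
  show thesis
    by (rule functional_over_scalar_field[OF assms(1) f(1,2)]) (use f(3) that in auto)
qed

lemma norming_functional:
  fixes sX :: "'k::{real_normed_field,euclidean_space} \<Rightarrow> 'a::real_normed_vector \<Rightarrow> 'a"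
  assumes "normed_space_over sX"
  obtains g where "g \<in> bounded_operators sX (*)" "norm g \<le> 1" "norm x \<le> blinfun_apply g x \<bullet> 1"
  by (rule norm_separation_over[OF assms, of "{x}" "norm x"]) (auto intro: that)


section \<open>Preduals of the space of summable sequences\<close>

lemma norm_blinfun_le_on_ball:
  assumes "\<And>x. norm x \<le> 1 \<Longrightarrow> norm (blinfun_apply f x) \<le> M"
  shows "norm f \<le> M"
proof (rule norm_blinfun_bound)
  show "0 \<le> M" using assms[of 0] by simp
  fix x
  show "norm (blinfun_apply f x) \<le> M * norm x"
  proof (cases "x = 0")
    case False
    then have "norm (blinfun_apply f (x /\<^sub>R norm x)) \<le> M" by (intro assms) simp
    then show ?thesis using False by (simp add: blinfun.scaleR_right divide_inverse_commute[symmetric] pos_divide_le_eq)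
  qed simp
qed

locale ell1_predual = normed_space_over sX
  for sX :: "'k::{real_normed_field,euclidean_space} \<Rightarrow> 'a::banach \<Rightarrow> 'a" +
  fixes \<Phi> :: "(nat \<Rightarrow> 'k) \<Rightarrow> ('a \<Rightarrow>\<^sub>L 'k)"
  assumes Phi_bij: "bij_betw \<Phi> ell1 (bounded_operators sX (*))"
    and Phi_add: "\<lbrakk>a \<in> ell1; b \<in> ell1\<rbrakk> \<Longrightarrow> \<Phi> (\<lambda>n. a n + b n) = \<Phi> a + \<Phi> b"
    and Phi_scale: "a \<in> ell1 \<Longrightarrow> blinfun_apply (\<Phi> (\<lambda>n. c * a n)) x = c * blinfun_apply (\<Phi> a) x"
    and norm_Phi: "a \<in> ell1 \<Longrightarrow> norm (\<Phi> a) = (\<Sum>n. norm (a n))"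
begin

text \<open>
  The coordinates of a point of \<open>X\<close>, when \<open>X\<close> is regarded as a subspace of the bounded scalar
  sequences.
\<close>

definition coord :: "nat \<Rightarrow> 'a \<Rightarrow> 'k" where
  "coord n = blinfun_apply (\<Phi> (\<lambda>i. if i = n then 1 else 0))"

lemma finite_support_ell1:
  "finite A \<Longrightarrow> (\<And>i. i \<notin> A \<Longrightarrow> a i = 0) \<Longrightarrow> a \<in> ell1"
  unfolding ell1_def using summable_finite[of A "\<lambda>n. norm (a n)"] by simp

lemma Phi_in_dual: "a \<in> ell1 \<Longrightarrow> \<Phi> a \<in> bounded_operators sX (*)"
  using Phi_bij by (auto simp: bij_betw_def)

lemma dual_scale:
  "g \<in> bounded_operators sX (*) \<Longrightarrow> blinfun_apply g (sX c x) = c * blinfun_apply g x"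
  using mem_dual_iff[OF normed_space_over_axioms] by blast

lemma unit_ell1: "(\<lambda>i. if i = n then 1 else 0) \<in> ell1"
  by (rule finite_support_ell1[of "{n}"]) auto

lemma coord_add: "coord n (x + y) = coord n x + coord n y"
  and coord_diff: "coord n (x - y) = coord n x - coord n y"
  and coord_scaleR: "coord n (r *\<^sub>R x) = r *\<^sub>R coord n x"
  by (simp_all add: coord_def blinfun.add_right blinfun.diff_right blinfun.scaleR_right)

lemma coord_scale: "coord n (sX c x) = c * coord n x"
  unfolding coord_def by (rule dual_scale[OF Phi_in_dual[OF unit_ell1]])

lemma coord_sum: "coord n (\<Sum>i\<in>A. f i) = (\<Sum>i\<in>A. coord n (f i))"
  by (simp add: coord_def blinfun.sum_right)

lemma norm_coord_le: "norm (coord n x) \<le> norm x"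
proof -
  have "norm (\<Phi> (\<lambda>i. if i = n then 1 else 0)) = (\<Sum>i. norm (if i = n then 1 else 0 :: 'k))"
    by (rule norm_Phi[OF unit_ell1])
  also have "\<dots> = 1"
    by (subst suminf_finite[of "{n}"]) auto
  finally show ?thesis
    unfolding coord_def using norm_blinfun[of "\<Phi> (\<lambda>i. if i = n then 1 else 0)" x] by simp
qed

lemma tendsto_coord: "(f \<longlongrightarrow> x) F \<Longrightarrow> ((\<lambda>n. coord i (f n)) \<longlongrightarrow> coord i x) F"
  unfolding coord_def by (intro tendsto_intros)

lemma Phi_truncated:
  "blinfun_apply (\<Phi> (\<lambda>i. if i < N then a i else 0)) x = (\<Sum>i<N. a i * coord i x)"
proof (induction N)
  case 0
  then show ?case using Phi_scale[OF unit_ell1, of 0] by simp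
next
  case (Suc N)
  have "(\<lambda>i. if i < Suc N then a i else 0)
      = (\<lambda>i. (if i < N then a i else 0) + a N * (if i = N then 1 else 0))" by (auto simp: less_Suc_eq)
  moreover have "(\<lambda>i. if i < N then a i else 0) \<in> ell1"
    by (rule finite_support_ell1[of "{..<N}"]) auto
  moreover have "(\<lambda>i. a N * (if i = N then 1 else 0)) \<in> ell1"
    by (rule finite_support_ell1[of "{N}"]) auto
  ultimately have "\<Phi> (\<lambda>i. if i < Suc N then a i else 0)
      = \<Phi> (\<lambda>i. if i < N then a i else 0) + \<Phi> (\<lambda>i. a N * (if i = N then 1 else 0))"
    by (simp only: Phi_add)
  then show ?case
    using Suc Phi_scale[OF unit_ell1, of "a N" N] by (simp add: blinfun.add_left coord_def)
qed

lemma norm_Phi_truncated: "norm (\<Phi> (\<lambda>i. if i < N then a i else 0)) = (\<Sum>i<N. norm (a i))"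
proof -
  have "(\<lambda>i. if i < N then a i else 0) \<in> ell1"
    by (rule finite_support_ell1[of "{..<N}"]) auto
  then have "norm (\<Phi> (\<lambda>i. if i < N then a i else 0)) = (\<Sum>i. norm (if i < N then a i else 0))"
    by (rule norm_Phi)
  also have "\<dots> = (\<Sum>i<N. norm (a i))" by (subst suminf_finite[of "{..<N}"]) auto
  finally show ?thesis .
qed

text \<open>
  A functional is the norm limit of its truncations, because the tails in \<open>\<ell>\<^sub>1\<close> tend to zero. The
  remainder is bounded by the exact norm of the tail, which gives uniformity on bounded sets.
\<close>

lemma dual_representation:
  assumes g: "g \<in> bounded_operators sX (*)"
  obtains b where "summable (\<lambda>n. norm (b n))" "norm g = (\<Sum>n. norm (b n))"
    "\<And>N x. norm (blinfun_apply g x - (\<Sum>n<N. b n * coord n x))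
        \<le> (norm g - (\<Sum>n<N. norm (b n))) * norm x"
proof -
  obtain b where b: "b \<in> ell1" "\<Phi> b = g"
    using g bij_betw_imp_surj_on[OF Phi_bij] by (metis imageE)
  have sb: "summable (\<lambda>n. norm (b n))" using b by (simp add: ell1_def)
  have "norm (blinfun_apply g x - (\<Sum>n<N. b n * coord n x))
        \<le> (norm g - (\<Sum>n<N. norm (b n))) * norm x" for N x
  proof -
    define hd tl where "hd i = (if i < N then b i else 0)" and "tl i = (if i < N then 0 else b i)" for i
    have hd: "hd \<in> ell1" unfolding hd_def by (rule finite_support_ell1[of "{..<N}"]) auto
    have stl: "summable (\<lambda>n. norm (tl n))"
      by (rule summable_comparison_test'[OF sb, of 0]) (auto simp: tl_def)
    then have tl: "tl \<in> ell1" by (simp add: ell1_def)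
    have "b = (\<lambda>n. hd n + tl n)" by (auto simp: hd_def tl_def)
    then have split: "g = \<Phi> hd + \<Phi> tl" using Phi_add[OF hd tl] b by simp
    have "norm g = (\<Sum>n. norm (hd n) + norm (tl n))"
      using norm_Phi[OF b(1)] b(2) by (auto simp: hd_def tl_def intro!: suminf_cong)
    also have "\<dots> = (\<Sum>n. norm (hd n)) + norm (\<Phi> tl)"
      using hd stl norm_Phi[OF tl] by (subst suminf_add[symmetric]) (auto simp: ell1_def)
    also have "(\<Sum>n. norm (hd n)) = (\<Sum>n<N. norm (b n))"
      using norm_Phi[OF hd] norm_Phi_truncated[of N b] by (simp add: hd_def[abs_def])
    finally have "norm (\<Phi> tl) = norm g - (\<Sum>n<N. norm (b n))" by simp
    moreover have "blinfun_apply g x - (\<Sum>n<N. b n * coord n x) = blinfun_apply (\<Phi> tl) x"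
      using Phi_truncated[of N b x] by (simp add: split blinfun.add_left hd_def[abs_def])
    ultimately show ?thesis using norm_blinfun[of "\<Phi> tl" x] by simp
  qed
  then show thesis using that sb norm_Phi[OF b(1)] b(2) by blast
qed

text \<open>
  Functionals respect coordinatewise limits of bounded sequences: the tail of the representing
  summable sequence is negligible on a bounded set, and the finitely many other terms see the limit.
  The bound uses only a bound \<open>d\<close> for the limiting coordinates, since the limit sequence itself
  does not have to come from a point of \<open>X\<close>.
\<close>

lemma eventually_dual_le:
  assumes g: "g \<in> bounded_operators sX (*)" and R: "\<And>k. norm (w k) \<le> R"
    and z: "\<And>n. (\<lambda>k. coord n (w k)) \<longlonglongrightarrow> z n" "\<And>n. norm (z n) \<le> d" and e: "0 < e"
  shows "\<forall>\<^sub>F k in sequentially. norm (blinfun_apply g (w k)) \<le> d * norm g + e"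
proof -
  obtain b where b: "summable (\<lambda>n. norm (b n))" "norm g = (\<Sum>n. norm (b n))"
    "\<And>N x. norm (blinfun_apply g x - (\<Sum>n<N. b n * coord n x))
        \<le> (norm g - (\<Sum>n<N. norm (b n))) * norm x"
    using dual_representation[OF g] by blast
  have partial: "(\<Sum>n<N. norm (b n)) \<le> norm g" for N
    unfolding b(2) by (rule sum_le_suminf[OF b(1)]) auto
  have "(\<lambda>N. (norm g - (\<Sum>n<N. norm (b n))) * R) \<longlonglongrightarrow> (norm g - norm g) * R"
    using summable_LIMSEQ[OF b(1)] b(2) by (intro tendsto_intros) simp
  then have "\<forall>\<^sub>F N in sequentially. (norm g - (\<Sum>n<N. norm (b n))) * R < e / 2"
    by (rule order_tendstoD) (use e in simp)
  then obtain N where N: "(norm g - (\<Sum>n<N. norm (b n))) * R < e / 2"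
    by (auto simp: eventually_sequentially)
  define e' where "e' = e / (2 * (norm g + 1))"
  have ge: "0 < 2 * (norm g + 1)" by (simp add: add_nonneg_pos)
  have e': "0 < e'" "norm g * e' \<le> e / 2"
    using e ge by (auto simp: e'_def field_simps)
  have "\<forall>\<^sub>F k in sequentially. \<forall>n\<in>{..<N}. norm (coord n (w k)) < d + e'"
  proof (rule eventually_ball_finite[OF finite_lessThan], intro ballI)
    fix n
    show "\<forall>\<^sub>F k in sequentially. norm (coord n (w k)) < d + e'"
      by (rule order_tendstoD(2)[OF tendsto_norm[OF z(1)]]) (use z(2)[of n] e' in linarith)
  qed
  then show ?thesis
  proof (rule eventually_mono)
    fix k assume k: "\<forall>n\<in>{..<N}. norm (coord n (w k)) < d + e'"
    have d0: "0 \<le> d" using z(2) norm_ge_zero order_trans by blast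
    have "norm (blinfun_apply g (w k))
        \<le> norm (\<Sum>n<N. b n * coord n (w k)) + (norm g - (\<Sum>n<N. norm (b n))) * norm (w k)"
      using b(3)[of "w k" N] norm_triangle_sub[of "blinfun_apply g (w k)" "\<Sum>n<N. b n * coord n (w k)"] by linarith
    also have "(norm g - (\<Sum>n<N. norm (b n))) * norm (w k) \<le> (norm g - (\<Sum>n<N. norm (b n))) * R"
      using R[of k] partial[of N] by (intro mult_left_mono) auto
    also have "\<dots> \<le> e / 2" using N by simp
    also have "norm (\<Sum>n<N. b n * coord n (w k)) \<le> (\<Sum>n<N. norm (b n) * (d + e'))"
    proof (rule sum_norm_le)
      show "norm (b n * coord n (w k)) \<le> norm (b n) * (d + e')" if "n \<in> {..<N}" for n
        using k that mult_left_mono[of "norm (coord n (w k))" "d + e'" "norm (b n)"] by (simp add: norm_mult less_imp_le)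
    qed
    also have "\<dots> \<le> norm g * (d + e')"
      using partial[of N] d0 e' by (auto simp flip: sum_distrib_right intro!: mult_right_mono)
    finally show "norm (blinfun_apply g (w k)) \<le> d * norm g + e"
      using e' by (simp add: algebra_simps)
  qed
qed

lemma almost_norming_vector:
  assumes M: "M < (\<Sum>i<N. norm (r i))"
  obtains u where "norm u \<le> 1" "M < (\<Sum>i<N. r i \<bullet> coord i u)"
proof -
  define G where "G = \<Phi> (\<lambda>i. if i < N then cj (r i) else 0)"
  have G: "blinfun_apply G x = (\<Sum>i<N. cj (r i) * coord i x)" for x
    unfolding G_def by (rule Phi_truncated)
  have "\<not> norm G \<le> M" using M norm_Phi_truncated[of N "\<lambda>i. cj (r i)"] by (simp add: G_def)
  then obtain u where u: "norm u \<le> 1" "M < norm (blinfun_apply G u)"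
    using norm_blinfun_le_on_ball[of G M] by force
  obtain l where l: "norm l = 1" "l * blinfun_apply G u = of_real (norm (blinfun_apply G u))"
    by (rule rotate_to_norm)
  have "(\<Sum>i<N. r i \<bullet> coord i (sX l u)) = (l * blinfun_apply G u) \<bullet> 1"
    by (simp add: inner_eq_cj[of "r _"] G coord_scale sum_distrib_left inner_sum_left algebra_simps)
  then show thesis using that[of "sX l u"] u l by (simp add: norm_scale)
qed

text \<open>
  A finite form of Goldstine's theorem. Let \<open>u\<close> almost minimise the Euclidean distance of the
  coordinates to \<open>z\<close>, with residual \<open>r = z - u\<close>. Moving from \<open>u\<close> towards any \<open>v\<close> in the ball cannot
  decrease the distance by much, so \<open>\<Sum>r\<^sub>i \<bullet> v\<^sub>i\<close> is almost maximal at \<open>u\<close>. But the maximum is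
  \<open>\<Sum>\<bar>r\<^sub>i\<bar>\<close> by the isometry with \<open>\<ell>\<^sub>1\<close> (\<open>almost_norming_vector\<close>), whereas its value at \<open>u\<close> is at
  most \<open>\<Sum>\<bar>r\<^sub>i\<bar> - \<Sum>\<bar>r\<^sub>i\<bar>\<^sup>2\<close>. Hence \<open>r\<close> is small.
\<close>

lemma ball_coord_dense:
  assumes z: "\<And>i. norm (z i) \<le> 1" and tau: "0 < \<tau>"
  obtains u where "norm u \<le> 1" "\<And>i. i < N \<Longrightarrow> norm (coord i u - z i) \<le> \<tau>"
proof -
  define D where "D u = (\<Sum>i<N. (norm (z i - coord i u))\<^sup>2)" for u
  define t where "t = min (1/2) (\<tau>\<^sup>2 / (1 + 4 * N))"
  have "0 < \<tau>\<^sup>2 / (1 + 4 * real N)" using tau by simp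
  then have t: "0 < t" "t \<le> 1" "t \<le> \<tau>\<^sup>2 / (1 + 4 * real N)" unfolding t_def by auto
  then have t3: "t * (1 + 4 * real N) \<le> \<tau>\<^sup>2" by (simp add: pos_le_divide_eq)
  define m where "m = Inf (D ` cball 0 1)"
  have D0: "0 \<le> D u" for u unfolding D_def by (intro sum_nonneg) auto
  have bdd: "bdd_below (D ` cball 0 1)" using D0 by (auto intro!: bdd_belowI)
  have mD: "m \<le> D v" if "norm v \<le> 1" for v
    unfolding m_def by (rule cInf_lower[OF _ bdd]) (use that in auto)
  have "\<exists>d\<in>D ` cball 0 1. d < m + t\<^sup>2"
    by (rule cInf_lessD) (use t in \<open>auto simp: m_def\<close>)
  then obtain u where u: "norm u \<le> 1" "D u < m + t\<^sup>2" by auto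
  define r where "r i = z i - coord i u" for i
  have var: "(\<Sum>i<N. r i \<bullet> coord i v) \<le> (\<Sum>i<N. r i \<bullet> coord i u) + t * (1 + 4 * N) / 2"
    if v: "norm v \<le> 1" for v
  proof -
    define h where "h i = coord i v - coord i u" for i
    \<comment> \<open>The excess \<open>t\<^sup>2\<close> of \<open>u\<close> over the infimum is of the same order as the quadratic term.\<close>
    have "(1 - t) *\<^sub>R u + t *\<^sub>R v \<in> cball 0 1"
      using t u v by (intro convexD[OF convex_cball]) auto
    then have "m \<le> D ((1 - t) *\<^sub>R u + t *\<^sub>R v)" by (intro mD) simp
    also have "\<dots> = (\<Sum>i<N. (norm (r i))\<^sup>2 - 2 * t * (r i \<bullet> h i) + t\<^sup>2 * (norm (h i))\<^sup>2)"
      unfolding D_def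
    proof (rule sum.cong[OF refl])
      fix i
      have "z i - coord i ((1 - t) *\<^sub>R u + t *\<^sub>R v) = r i - t *\<^sub>R h i"
        by (simp only: r_def h_def coord_add coord_scaleR) (simp add: algebra_simps)
      moreover have "(norm (r i - t *\<^sub>R h i))\<^sup>2 = (norm (r i))\<^sup>2 - 2 * t * (r i \<bullet> h i) + t\<^sup>2 * (norm (h i))\<^sup>2"
        unfolding power2_norm_eq_inner
        by (simp add: inner_diff_left inner_diff_right inner_commute power2_eq_square algebra_simps)
      ultimately show "(norm (z i - coord i ((1 - t) *\<^sub>R u + t *\<^sub>R v)))\<^sup>2
          = (norm (r i))\<^sup>2 - 2 * t * (r i \<bullet> h i) + t\<^sup>2 * (norm (h i))\<^sup>2"
        by simp
    qed
    also have "\<dots> = D u - 2 * t * (\<Sum>i<N. r i \<bullet> h i) + t\<^sup>2 * (\<Sum>i<N. (norm (h i))\<^sup>2)"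
      by (simp add: D_def r_def sum.distrib sum_subtractf sum_distrib_left)
    finally have mle: "m \<le> D u - 2 * t * (\<Sum>i<N. r i \<bullet> h i) + t\<^sup>2 * (\<Sum>i<N. (norm (h i))\<^sup>2)" .
    have "(\<Sum>i<N. (norm (h i))\<^sup>2) \<le> (\<Sum>i<N. 4)"
    proof (rule sum_mono)
      fix i
      have "norm (h i) \<le> 2" unfolding h_def
        using norm_coord_le[of i v] norm_coord_le[of i u] u v norm_triangle_ineq4[of "coord i v" "coord i u"] by linarith
      then show "(norm (h i))\<^sup>2 \<le> 4" using power_mono[of "norm (h i)" 2 2] by simp
    qed
    then have "t\<^sup>2 * (\<Sum>i<N. (norm (h i))\<^sup>2) \<le> t\<^sup>2 * (\<Sum>i<N. 4)"
      by (rule mult_left_mono) simp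
    then have "2 * t * (\<Sum>i<N. r i \<bullet> h i) \<le> t\<^sup>2 * (1 + 4 * N)"
      using u(2) mle by (simp add: algebra_simps)
    then have "t * (2 * (\<Sum>i<N. r i \<bullet> h i)) \<le> t * (t * (1 + 4 * N))"
      by (simp add: power2_eq_square algebra_simps)
    then have "2 * (\<Sum>i<N. r i \<bullet> h i) \<le> t * (1 + 4 * N)" using t(1) by (simp only: mult_le_cancel_left_pos)
    then show ?thesis by (simp add: h_def inner_diff_right sum_subtractf)
  qed
  have "(\<Sum>i<N. norm (r i)) \<le> (\<Sum>i<N. r i \<bullet> coord i u) + t * (1 + 4 * N) / 2"
  proof (rule ccontr)
    assume "\<not> ?thesis"
    then obtain v where "norm v \<le> 1" "(\<Sum>i<N. r i \<bullet> coord i u) + t * (1 + 4 * N) / 2 < (\<Sum>i<N. r i \<bullet> coord i v)"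
      using almost_norming_vector[of "(\<Sum>i<N. r i \<bullet> coord i u) + t * (1 + 4 * N) / 2" r N] by (auto simp: not_le)
    then show False using var[of v] by simp
  qed
  also have "(\<Sum>i<N. r i \<bullet> coord i u) \<le> (\<Sum>i<N. norm (r i) - (norm (r i))\<^sup>2)"
  proof (rule sum_mono)
    fix i
    have "r i \<bullet> coord i u = r i \<bullet> z i - r i \<bullet> r i" by (simp add: r_def algebra_simps)
    also have "r i \<bullet> z i \<le> norm (r i) * norm (z i)" by (rule norm_cauchy_schwarz)
    also have "\<dots> \<le> norm (r i)" using z[of i] by (simp add: mult_left_le)
    finally show "r i \<bullet> coord i u \<le> norm (r i) - (norm (r i))\<^sup>2" by (simp add: power2_norm_eq_inner)
  qed
  finally have "D u \<le> t * (1 + 4 * N) / 2" by (simp add: D_def r_def sum_subtractf)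
  then have "D u * 2 \<le> t * (1 + 4 * real N)" by simp
  then have Du: "D u \<le> \<tau>\<^sup>2" using t3 zero_le_power2[of \<tau>] by linarith
  have "norm (coord i u - z i) \<le> \<tau>" if "i < N" for i
  proof -
    have "(norm (z i - coord i u))\<^sup>2 \<le> D u"
      unfolding D_def by (rule member_le_sum) (use that in auto)
    then have "(norm (coord i u - z i))\<^sup>2 \<le> \<tau>\<^sup>2" using Du by (simp add: norm_minus_commute)
    then show ?thesis by (rule power2_le_imp_le) (use tau in simp)
  qed
  then show thesis using that u(1) by blast
qed

lemma ball_coord_sequence:
  assumes z: "\<And>i. norm (z i) \<le> 1"
  obtains u where "\<And>k. norm (u k) \<le> 1" "\<And>n. (\<lambda>k. coord n (u k)) \<longlonglongrightarrow> z n"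
proof -
  have "\<exists>u. norm u \<le> 1 \<and> (\<forall>i<k. norm (coord i u - z i) \<le> inverse (real (Suc k)))" for k
    by (rule ball_coord_dense[of z "inverse (real (Suc k))" k]) (use z in auto)
  then obtain u where u: "\<And>k. norm (u k) \<le> 1"
    "\<And>k i. i < k \<Longrightarrow> norm (coord i (u k) - z i) \<le> inverse (real (Suc k))" by metis
  have "(\<lambda>k. coord n (u k)) \<longlonglongrightarrow> z n" for n
  proof (rule LIM_zero_cancel)
    show "(\<lambda>k. coord n (u k) - z n) \<longlonglongrightarrow> 0"
      by (rule Lim_null_comparison[OF _ LIMSEQ_inverse_real_of_nat])
        (use u(2) in \<open>auto simp: eventually_sequentially intro!: exI[of _ "Suc n"]\<close>)
  qed
  then show thesis using that u(1) by blast
qed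

text \<open>
  The sequence \<open>z'\<close> with the entries \<open>z\<close> on \<open>A\<close> and those of \<open>x\<close> elsewhere lies in the ball and
  has distance at most \<open>\<delta>\<close> from \<open>x\<close>, but it need not come from \<open>X\<close>. Points \<open>u k\<close> of the ball
  converge to it coordinatewise only. If no admissible \<open>u\<close> were close to \<open>x\<close> in norm, a functional of
  norm at most one would separate \<open>x\<close> from all of them by more than \<open>\<delta>\<close>, and it could not respect
  the limit \<open>u k - x \<rightarrow> z' - x\<close>.
\<close>

lemma move_coords_approximately:
  assumes A: "finite A" and z: "\<And>i. i \<in> A \<Longrightarrow> norm (z i) \<le> 1" and x: "norm x \<le> 1"
    and close: "\<And>i. i \<in> A \<Longrightarrow> norm (coord i x - z i) \<le> \<delta>" and d: "0 \<le> \<delta>" and tau: "0 < \<tau>"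
  shows "\<exists>u. norm u \<le> 1 \<and> (\<forall>i\<in>A. norm (coord i u - z i) \<le> \<tau>) \<and> norm (u - x) \<le> \<delta> + \<tau>"
proof (rule ccontr)
  assume neg: "\<not> ?thesis"
  define U where "U = {u. norm u \<le> 1 \<and> (\<forall>i\<in>A. norm (coord i u - z i) \<le> \<tau>)}"
  define z' where "z' i = (if i \<in> A then z i else coord i x)" for i
  have "norm (z' i) \<le> 1" for i
    using z[of i] norm_coord_le[of i x] x by (auto simp: z'_def)
  then obtain u where u: "\<And>k. norm (u k) \<le> 1" "\<And>n. (\<lambda>k. coord n (u k)) \<longlonglongrightarrow> z' n"
    using ball_coord_sequence[of z'] by blast
  have "\<forall>\<^sub>F k in sequentially. \<forall>i\<in>A. norm (coord i (u k) - z i) \<le> \<tau>"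
  proof (rule eventually_ball_finite[OF A], intro ballI)
    fix i assume "i \<in> A"
    then have "(\<lambda>k. coord i (u k)) \<longlonglongrightarrow> z i" using u(2)[of i] by (simp add: z'_def)
    then have "(\<lambda>k. norm (coord i (u k) - z i)) \<longlonglongrightarrow> 0"
      by (intro tendsto_norm_zero LIM_zero)
    then show "\<forall>\<^sub>F k in sequentially. norm (coord i (u k) - z i) \<le> \<tau>"
      by (rule eventually_mono[OF order_tendstoD(2)[OF _ tau]]) simp
  qed
  then have evU: "\<forall>\<^sub>F k in sequentially. u k \<in> U"
    by (rule eventually_mono) (use u(1) in \<open>auto simp: U_def\<close>)
  then have "U \<noteq> {}" by (auto simp: eventually_sequentially)
  have "convex U"
  proof -
    have "U = cball 0 1 \<inter> (\<Inter>i\<in>A. coord i -` cball (z i) \<tau>)"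
      by (auto simp: U_def dist_norm norm_minus_commute)
    moreover have "linear (coord i)" for i
      by (rule linearI) (auto simp: coord_add coord_scaleR)
    ultimately show ?thesis
      by (simp add: convex_Int convex_INT convex_linear_vimage)
  qed
  then have "convex ((\<lambda>u. u - x) ` U)" by (simp add: convex_translation_subtract)
  moreover have "\<delta> + \<tau> \<le> norm c" if cU: "c \<in> (\<lambda>u. u - x) ` U" for c
  proof (rule ccontr)
    assume c: "\<not> \<delta> + \<tau> \<le> norm c"
    obtain u where "u \<in> U" "c = u - x" using cU by blast
    then show False using c neg by (auto simp: U_def)
  qed
  ultimately obtain g where g: "g \<in> bounded_operators sX (*)" "norm g \<le> 1"
    "\<And>c. c \<in> (\<lambda>u. u - x) ` U \<Longrightarrow> \<delta> + \<tau> \<le> blinfun_apply g c \<bullet> 1"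
    using norm_separation_over[OF normed_space_over_axioms, of "(\<lambda>u. u - x) ` U" "\<delta> + \<tau>"] \<open>U \<noteq> {}\<close> by blast
  have "\<forall>\<^sub>F k in sequentially. norm (blinfun_apply g (u k - x)) \<le> \<delta> * norm g + \<tau> / 2"
  proof (rule eventually_dual_le[OF g(1)])
    show "norm (u k - x) \<le> 2" for k using u(1)[of k] x norm_triangle_ineq4[of "u k" x] by linarith
    show "(\<lambda>k. coord n (u k - x)) \<longlonglongrightarrow> z' n - coord n x" for n
      unfolding coord_diff by (intro tendsto_intros u(2))
    show "norm (z' n - coord n x) \<le> \<delta>" for n
      using close[of n] d by (auto simp: z'_def norm_minus_commute)
  qed (use tau in simp)
  with evU have "\<forall>\<^sub>F k in sequentially. False"
  proof eventually_elim
    case (elim k)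
    then have "\<delta> + \<tau> \<le> norm (blinfun_apply g (u k - x))"
      using g(3) inner_one_le_norm order_trans by blast
    moreover have "\<delta> * norm g \<le> \<delta>" using g(2) d by (simp add: mult_left_le)
    ultimately show False using elim(2) tau by simp
  qed
  then show False by simp
qed

text \<open>
  The approximate correction is repeated with errors \<open>\<delta> / 2\<^sup>n\<close>; the steps are bounded by
  \<open>2 \<delta> / 2\<^sup>n\<close> and hence sum to \<open>4 \<delta>\<close>.
\<close>

lemma move_coords_exactly:
  assumes A: "finite A" and z: "\<And>i. i \<in> A \<Longrightarrow> norm (z i) \<le> 1" and x: "norm x \<le> 1"
    and close: "\<And>i. i \<in> A \<Longrightarrow> norm (coord i x - z i) \<le> \<delta>" and d: "0 < \<delta>"
  obtains x' where "norm x' \<le> 1" "\<And>i. i \<in> A \<Longrightarrow> coord i x' = z i" "norm (x' - x) \<le> 4 * \<delta>"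
proof -
  define P where "P n y \<longleftrightarrow> (n = 0 \<longrightarrow> y = x) \<and> norm y \<le> 1 \<and> (\<forall>i\<in>A. norm (coord i y - z i) \<le> \<delta> * (1/2)^n)" for n y
  define Q where "Q n y y' \<longleftrightarrow> norm (y' - y) \<le> 2 * \<delta> * (1/2)^n" for n :: nat and y y' :: 'a
  have "\<exists>f. \<forall>n. P n (f n) \<and> Q n (f n) (f (Suc n))"
  proof (rule dependent_nat_choice)
    show "\<exists>y. P 0 y" using x close by (auto simp: P_def)
    fix y n assume y: "P n y"
    let ?d = "\<delta> * (1/2)^n"
    have d0: "0 < ?d" using d by simp
    show "\<exists>y'. P (Suc n) y' \<and> Q n y y'"
    proof -
      have "\<exists>u. norm u \<le> 1 \<and> (\<forall>i\<in>A. norm (coord i u - z i) \<le> ?d / 2) \<and> norm (u - y) \<le> ?d + ?d / 2"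
        by (rule move_coords_approximately[OF A z]) (use y d0 in \<open>auto simp: P_def\<close>)
      then show ?thesis using d0 by (auto simp: P_def Q_def)
    qed
  qed
  then obtain f where f: "\<And>n. P n (f n)" "\<And>n. Q n (f n) (f (Suc n))" by blast
  have f0: "f 0 = x" using f(1)[of 0] by (simp add: P_def)
  define s where "s = (\<Sum>n. f (Suc n) - f n)"
  have geo: "(\<lambda>n. 2 * \<delta> * (1/2)^n) sums (4 * \<delta>)"
    using sums_mult[OF geometric_sums[of "1/2 :: real"], of "2 * \<delta>"] by simp
  have le: "norm (f (Suc n) - f n) \<le> 2 * \<delta> * (1/2)^n" for n using f(2)[of n] by (simp add: Q_def)
  have "summable (\<lambda>n. f (Suc n) - f n)"
    by (rule summable_comparison_test'[OF sums_summable[OF geo], of 0]) (use le in auto)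
  then have "(\<lambda>n. \<Sum>i<n. f (Suc i) - f i) \<longlonglongrightarrow> s" unfolding s_def by (rule summable_LIMSEQ)
  then have "(\<lambda>n. x + (\<Sum>i<n. f (Suc i) - f i)) \<longlonglongrightarrow> x + s" by (intro tendsto_intros)
  then have lim: "f \<longlonglongrightarrow> x + s" by (simp add: sum_lessThan_telescope f0)
  show thesis
  proof (rule that[of "x + s"])
    show "norm (x + s) \<le> 1"
      by (rule LIMSEQ_le_const2[OF tendsto_norm[OF lim]]) (use f(1) in \<open>auto simp: P_def\<close>)
    have "norm s \<le> (\<Sum>n. 2 * \<delta> * (1/2)^n)"
      unfolding s_def by (rule norm_suminf_le[OF le sums_summable[OF geo]])
    then show "norm (x + s - x) \<le> 4 * \<delta>" using sums_unique[OF geo] by simp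
    fix i assume i: "i \<in> A"
    have "(\<lambda>n. coord i (f n) - z i) \<longlonglongrightarrow> 0"
    proof (rule Lim_null_comparison)
      show "\<forall>\<^sub>F n in sequentially. norm (coord i (f n) - z i) \<le> \<delta> * (1/2)^n"
        using f(1) i by (auto simp: P_def)
      show "(\<lambda>n. \<delta> * (1/2)^n) \<longlonglongrightarrow> 0" by (intro tendsto_mult_right_zero LIMSEQ_power_zero) simp
    qed
    moreover have "(\<lambda>n. coord i (f n) - z i) \<longlonglongrightarrow> coord i (x + s) - z i"
      by (intro tendsto_intros tendsto_coord lim)
    ultimately have "coord i (x + s) - z i = 0" by (rule LIMSEQ_unique[symmetric])
    then show "coord i (x + s) = z i" by simp
  qed
qed

end


section \<open>Compact operators and finitely many coordinates\<close>

text \<open>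
  The unit ball of \<open>\<ell>\<^sub>\<infinity>\<close>. As a set of functions it carries the product topology, for which it is
  compact.
\<close>

definition unit_sequences :: "(nat \<Rightarrow> 'k::real_normed_vector) set" where
  "unit_sequences = {w. \<forall>n. norm (w n) \<le> 1}"

text \<open>
  The action on \<open>\<ell>\<^sub>\<infinity>\<close> of an operator that depends only on the coordinates in \<open>A\<close>; the vectors
  \<open>y i\<close> are its values at the unit vectors.
\<close>

definition combination ::
  "('k::real_normed_field \<Rightarrow> 'b::real_normed_vector \<Rightarrow> 'b) \<Rightarrow> nat set \<Rightarrow> (nat \<Rightarrow> 'b) \<Rightarrow> (nat \<Rightarrow> 'k) \<Rightarrow> 'b"
  where "combination sY A y w = (\<Sum>i\<in>A. sY (w i) (y i))"

lemma compact_unit_sequences: "compact (unit_sequences :: (nat \<Rightarrow> 'k::euclidean_space) set)"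
proof -
  have "compactin (product_topology (\<lambda>i::nat. euclidean :: 'k topology) UNIV) (PiE UNIV (\<lambda>_. cball 0 1))"
    by (simp add: compactin_PiE)
  moreover have "PiE UNIV (\<lambda>_. cball 0 1) = (unit_sequences :: (nat \<Rightarrow> 'k) set)"
    by (auto simp: unit_sequences_def)
  ultimately show ?thesis
    by (simp add: euclidean_product_topology)
qed

lemma unit_sequences_subsequence:
  fixes w :: "nat \<Rightarrow> nat \<Rightarrow> 'k::euclidean_space"
  assumes "\<And>k. w k \<in> unit_sequences"
  obtains r v where "strict_mono (r :: nat \<Rightarrow> nat)" "v \<in> unit_sequences" "\<And>n. (\<lambda>k. w (r k) n) \<longlonglongrightarrow> v n"
proof -
  obtain v r where v: "v \<in> unit_sequences" "strict_mono r" "(w \<circ> r) \<longlonglongrightarrow> v"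
    using compact_imp_seq_compact[OF compact_unit_sequences] assms unfolding seq_compact_def by metis
  have "(\<lambda>k. w (r k) n) \<longlonglongrightarrow> v n" for n
    using continuous_on_tendsto_compose[OF continuous_on_product_coordinates[of n] v(3)] by simp
  then show thesis using that v by blast
qed

context normed_space_over
begin

lemma continuous_on_combination: "continuous_on S (combination scale A y)"
  unfolding combination_def
  by (intro continuous_on_sum bounded_linear.continuous_on[OF bounded_linear_scale_left]
      continuous_on_subset[OF continuous_on_product_coordinates]) auto

lemma tendsto_combination:
  assumes "\<And>i. i \<in> A \<Longrightarrow> ((\<lambda>k. w k i) \<longlongrightarrow> v i) F"
  shows "((\<lambda>k. combination scale A y (w k)) \<longlongrightarrow> combination scale A y v) F"
  unfolding combination_def by (intro tendsto_sum tendsto_scale assms)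

lemma combination_add: "combination scale A y (\<lambda>i. v i + w i) = combination scale A y v + combination scale A y w"
  by (simp add: combination_def scale_left_distrib sum.distrib)

lemma combination_diff: "combination scale A y (\<lambda>i. v i - w i) = combination scale A y v - combination scale A y w"
  by (simp add: combination_def scale_left_diff_distrib sum_subtractf)

lemma combination_scale: "combination scale A y (\<lambda>i. c * w i) = scale c (combination scale A y w)"
  by (simp add: combination_def scale_sum_right)

end

lemma bounded_operators_scale:
  "T \<in> bounded_operators sX sY \<Longrightarrow> blinfun_apply T (sX c x) = sY c (blinfun_apply T x)"
  unfolding bounded_operators_def Vector_Spaces.linear_iff by simp

lemma functional_comp_operator:
  assumes "normed_space_over sX" "normed_space_over sY"
    and "T \<in> bounded_operators sX sY" "g \<in> bounded_operators sY (*)"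
  shows "g o\<^sub>L T \<in> bounded_operators sX (*)"
  using assms bounded_operators_scale[OF assms(3)] by (simp add: mem_dual_iff)

context ell1_predual
begin

text \<open>
  By compactness a subsequence of the images would converge to a vector \<open>y \<noteq> 0\<close>; a functional that
  norms \<open>y\<close>, composed with \<open>T\<close>, is a functional on \<open>X\<close> and so tends to zero along the sequence.
\<close>

lemma compact_operator_tendsto_zero:
  fixes sY :: "'k \<Rightarrow> 'b::real_normed_vector \<Rightarrow> 'b"
  assumes sY: "normed_space_over sY" and T: "T \<in> compact_operators sX sY"
    and R: "\<And>k. norm (w k) \<le> R" and w: "\<And>n. (\<lambda>k. coord n (w k)) \<longlonglongrightarrow> 0"
  shows "(\<lambda>k. blinfun_apply T (w k)) \<longlonglongrightarrow> 0"
proof (rule ccontr)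
  assume "\<not> ?thesis"
  then obtain e where e: "0 < e" "\<And>N. \<exists>k\<ge>N. e \<le> norm (blinfun_apply T (w k))"
    unfolding lim_sequentially by (auto simp: not_less)
  define S where "S = {k. e \<le> norm (blinfun_apply T (w k))}"
  have "infinite S" unfolding S_def infinite_nat_iff_unbounded_le using e(2) by auto
  then obtain r where r: "strict_mono r" "\<And>k::nat. r k \<in> S"
    using infinite_enumerate by blast
  \<comment> \<open>One is added so that the radius is positive even when \<open>R = 0\<close>.\<close>
  define R' where "R' = R + 1"
  have R': "0 < R'" "norm (w k) \<le> R'" for k
    using R[of k] norm_ge_zero[of "w k"] unfolding R'_def by linarith+
  define p where "p k = w (r k) /\<^sub>R R'" for k
  have p: "norm (p k) \<le> 1" for k
    using R'(1) R'(2)[of "r k"] by (simp add: p_def divide_inverse_commute[symmetric] pos_divide_le_eq)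
  have cpt: "compact (closure (blinfun_apply T ` cball 0 1))" and TB: "T \<in> bounded_operators sX sY"
    using T by (auto simp: compact_operators_def)
  have "blinfun_apply T (p k) \<in> closure (blinfun_apply T ` cball 0 1)" for k
    using p[of k] closure_subset by fastforce
  then obtain y s where y: "strict_mono s" "((\<lambda>k. blinfun_apply T (p k)) \<circ> s) \<longlonglongrightarrow> y"
    using compact_imp_seq_compact[OF cpt] unfolding seq_compact_def by metis
  then have lim: "(\<lambda>k. blinfun_apply T (p (s k))) \<longlonglongrightarrow> y" by (simp add: o_def)
  have "e / R' \<le> norm (blinfun_apply T (p (s k)))" for k
    using mult_left_mono[of e "norm (blinfun_apply T (w (r (s k))))" "inverse R'"] r(2)[of "s k"] R'(1)
    by (simp add: p_def S_def blinfun.scaleR_right divide_inverse mult.commute)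
  then have y_large: "e / R' \<le> norm y"
    by (intro LIMSEQ_le_const[OF tendsto_norm[OF lim]]) auto
  obtain g where g: "g \<in> bounded_operators sY (*)" "norm y \<le> blinfun_apply g y \<bullet> 1"
    using norming_functional[OF sY] by blast
  have "blinfun_apply g y = 0"
  proof (rule ccontr)
    assume ne: "blinfun_apply g y \<noteq> 0"
    let ?d = "norm (blinfun_apply g y) / 2"
    have gT: "g o\<^sub>L T \<in> bounded_operators sX (*)"
      by (rule functional_comp_operator[OF normed_space_over_axioms sY TB g(1)])
    have "\<forall>\<^sub>F k in sequentially. norm (blinfun_apply (g o\<^sub>L T) (p (s k))) \<le> 0 * norm (g o\<^sub>L T) + ?d"
    proof (rule eventually_dual_le[OF gT])
      show "norm (p (s k)) \<le> 1" for k by (rule p)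
      have "(\<lambda>k. coord n (w (r (s k)))) \<longlonglongrightarrow> 0" for n
        using LIMSEQ_subseq_LIMSEQ[OF w[of n] strict_mono_o[OF r(1) y(1)]] by (simp add: o_def)
      then have "(\<lambda>k. inverse R' *\<^sub>R coord n (w (r (s k)))) \<longlonglongrightarrow> inverse R' *\<^sub>R 0" for n
        by (intro tendsto_scaleR tendsto_const)
      then show "(\<lambda>k. coord n (p (s k))) \<longlonglongrightarrow> 0" for n by (simp add: p_def coord_scaleR)
    qed (use ne in auto)
    then have "\<forall>\<^sub>F k in sequentially. norm (blinfun_apply g (blinfun_apply T (p (s k)))) \<le> ?d" by simp
    moreover have "(\<lambda>k. norm (blinfun_apply g (blinfun_apply T (p (s k))))) \<longlonglongrightarrow> norm (blinfun_apply g y)"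
      by (intro tendsto_intros lim)
    ultimately have "norm (blinfun_apply g y) \<le> ?d"
      by (intro tendsto_upperbound) auto
    then show False using ne by simp
  qed
  then have "norm y \<le> 0" using g(2) by simp
  moreover have "0 < e / R'" using e(1) R'(1) by simp
  ultimately show False using y_large by linarith
qed

text \<open>
  The vector \<open>y i\<close> is the limit of \<open>T\<close> along points of the ball that converge coordinatewise to the
  \<open>i\<close>-th unit vector. If the approximation failed for every \<open>N\<close>, at points \<open>x N\<close> of the ball,
  then one could choose \<open>w N\<close> in the ball that nearly agrees with \<open>x N\<close> on the first \<open>N\<close>
  coordinates and whose image is close to the \<open>N\<close>-th approximant at \<open>x N\<close>. The differences
  \<open>w N - x N\<close> tend to zero coordinatewise, so their images tend to zero, a contradiction.
\<close>

lemma compact_operator_finite_coords: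
  fixes sY :: "'k \<Rightarrow> 'b::real_normed_vector \<Rightarrow> 'b"
  assumes sY: "normed_space_over sY" and T: "T \<in> compact_operators sX sY" and e: "0 < e"
  obtains N y where "\<And>x. norm x \<le> 1 \<Longrightarrow>
    norm (blinfun_apply T x - combination sY {..<N} y (\<lambda>i. coord i x)) \<le> e"
proof -
  interpret Y: normed_space_over sY by fact
  have cpt: "compact (closure (blinfun_apply T ` cball 0 1))" and TB: "T \<in> bounded_operators sX sY"
    using T by (auto simp: compact_operators_def)
  have "\<exists>v y. (\<forall>k. norm (v k) \<le> 1) \<and> (\<forall>n. (\<lambda>k. coord n (v k)) \<longlonglongrightarrow> (if n = i then 1 else 0))
      \<and> (\<lambda>k. blinfun_apply T (v k)) \<longlonglongrightarrow> y" for i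
  proof -
    obtain v where v: "\<And>k. norm (v k) \<le> 1" "\<And>n. (\<lambda>k. coord n (v k)) \<longlonglongrightarrow> (if n = i then 1 else 0)"
      by (rule ball_coord_sequence[of "\<lambda>n. if n = i then 1 else 0"]) auto
    have "blinfun_apply T (v k) \<in> closure (blinfun_apply T ` cball 0 1)" for k
      using v(1)[of k] closure_subset by fastforce
    then obtain y s where y: "strict_mono s" "((\<lambda>k. blinfun_apply T (v k)) \<circ> s) \<longlonglongrightarrow> y"
      using compact_imp_seq_compact[OF cpt] unfolding seq_compact_def by metis
    have "(\<lambda>k. coord n (v (s k))) \<longlonglongrightarrow> (if n = i then 1 else 0)" for n
      using LIMSEQ_subseq_LIMSEQ[OF v(2)[of n] y(1)] by (simp add: o_def)
    then show ?thesis using v(1) y(2) by (intro exI[of _ "v \<circ> s"] exI[of _ y]) (auto simp: o_def)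
  qed
  then obtain v y where v: "\<And>i k. norm (v i k) \<le> 1"
    "\<And>i n. (\<lambda>k. coord n (v i k)) \<longlonglongrightarrow> (if n = i then 1 else 0)"
    "\<And>i. (\<lambda>k. blinfun_apply T (v i k)) \<longlonglongrightarrow> y i" by metis
  define U where "U N x = combination sY {..<N} y (\<lambda>i. coord i x)" for N x
  have lift: "\<exists>w. norm w \<le> 1 \<and> (\<forall>n<N. norm (coord n w - coord n x) \<le> inverse (real (Suc N))) \<and>
      norm (blinfun_apply T w - U N x) \<le> e / 2" if x: "norm x \<le> 1" for x N
  proof -
    define c where "c n = (if n < N then coord n x else 0)" for n
    have "norm (c n) \<le> 1" for n using norm_coord_le[of n x] x by (auto simp: c_def)
    then obtain w where w: "\<And>k. norm (w k) \<le> 1" "\<And>n. (\<lambda>k. coord n (w k)) \<longlonglongrightarrow> c n"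
      using ball_coord_sequence[of c] by blast
    \<comment> \<open>The points \<open>q k\<close> have the right limit under \<open>T\<close>, but only the points \<open>w k\<close> lie in the unit ball.\<close>
    define q where "q k = (\<Sum>i<N. sX (c i) (v i k))" for k
    have "norm (q k) \<le> (\<Sum>i<N. norm (c i))" for k
      unfolding q_def by (rule sum_norm_le) (use v(1) in \<open>auto simp: norm_scale intro: mult_left_le\<close>)
    then have bd: "norm (w k - q k) \<le> 1 + (\<Sum>i<N. norm (c i))" for k
      using norm_triangle_ineq4[of "w k" "q k"] w(1)[of k] by (meson add_mono order_trans)
    have "(\<lambda>k. coord n (q k)) \<longlonglongrightarrow> (\<Sum>i<N. c i * (if n = i then 1 else 0))" for n
      unfolding q_def coord_sum coord_scale by (intro tendsto_intros v(2))
    moreover have "(\<Sum>i<N. c i * (if n = i then 1 else 0)) = c n" for n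
      by (simp add: c_def if_distrib cong: if_cong)
    ultimately have "(\<lambda>k. coord n (q k)) \<longlonglongrightarrow> c n" for n by simp
    then have coords: "(\<lambda>k. coord n (w k - q k)) \<longlonglongrightarrow> c n - c n" for n
      unfolding coord_diff by (rule tendsto_diff[OF w(2)])
    have "(\<lambda>k. blinfun_apply T (w k - q k)) \<longlonglongrightarrow> 0"
      by (rule compact_operator_tendsto_zero[OF sY T bd]) (use coords in simp)
    moreover have "(\<lambda>k. blinfun_apply T (q k)) \<longlonglongrightarrow> (\<Sum>i<N. sY (c i) (y i))"
      unfolding q_def blinfun.sum_right bounded_operators_scale[OF TB]
      by (intro tendsto_sum bounded_linear.tendsto[OF Y.bounded_linear_scale_right] v(3))
    ultimately have "(\<lambda>k. blinfun_apply T (w k - q k) + blinfun_apply T (q k)) \<longlonglongrightarrow> 0 + (\<Sum>i<N. sY (c i) (y i))"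
      by (rule tendsto_add)
    moreover have "(\<Sum>i<N. sY (c i) (y i)) = U N x" by (simp add: U_def combination_def c_def)
    ultimately have "(\<lambda>k. blinfun_apply T (w k)) \<longlonglongrightarrow> U N x"
      by (simp add: blinfun.diff_right)
    then have "\<forall>\<^sub>F k in sequentially. norm (blinfun_apply T (w k) - U N x) < e / 2"
      unfolding dist_norm[symmetric] by (rule tendstoD[OF _ half_gt_zero[OF e]])
    moreover have "\<forall>\<^sub>F k in sequentially. \<forall>n\<in>{..<N}. norm (coord n (w k) - coord n x) < inverse (real (Suc N))"
    proof (rule eventually_ball_finite[OF finite_lessThan], intro ballI)
      fix n assume "n \<in> {..<N}"
      then have "(\<lambda>k. coord n (w k)) \<longlonglongrightarrow> coord n x" using w(2)[of n] by (simp add: c_def)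
      then show "\<forall>\<^sub>F k in sequentially. norm (coord n (w k) - coord n x) < inverse (real (Suc N))"
        unfolding tendsto_iff dist_norm by (meson inverse_positive_iff_positive of_nat_0_less_iff zero_less_Suc)
    qed
    ultimately have "\<forall>\<^sub>F k in sequentially. norm (blinfun_apply T (w k) - U N x) < e / 2 \<and>
        (\<forall>n\<in>{..<N}. norm (coord n (w k) - coord n x) < inverse (real (Suc N)))"
      by (rule eventually_conj)
    then obtain k where "norm (blinfun_apply T (w k) - U N x) < e / 2 \<and>
        (\<forall>n\<in>{..<N}. norm (coord n (w k) - coord n x) < inverse (real (Suc N)))"
      using eventually_happens'[OF sequentially_bot] by blast
    then show ?thesis using w(1)[of k] by (intro exI[of _ "w k"]) (auto intro: less_imp_le)
  qed
  have "\<exists>N. \<forall>x. norm x \<le> 1 \<longrightarrow> norm (blinfun_apply T x - U N x) \<le> e"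
  proof (rule ccontr)
    assume "\<not> ?thesis"
    then have "\<forall>N. \<exists>x. norm x \<le> 1 \<and> e < norm (blinfun_apply T x - U N x)" by (auto simp: not_le)
    then obtain x where x: "\<And>N. norm (x N) \<le> 1" "\<And>N. e < norm (blinfun_apply T (x N) - U N (x N))"
      by metis
    obtain w where w: "\<And>N. norm (w N) \<le> 1"
      "\<And>N n. n < N \<Longrightarrow> norm (coord n (w N) - coord n (x N)) \<le> inverse (real (Suc N))"
      "\<And>N. norm (blinfun_apply T (w N) - U N (x N)) \<le> e / 2" 
    proof -
      have "\<forall>N. \<exists>w. norm w \<le> 1 \<and> (\<forall>n<N. norm (coord n w - coord n (x N)) \<le> inverse (real (Suc N))) \<and>
          norm (blinfun_apply T w - U N (x N)) \<le> e / 2" by (intro allI lift x(1))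
      then show ?thesis using that by metis
    qed
    have "(\<lambda>N. blinfun_apply T (w N - x N)) \<longlonglongrightarrow> 0"
    proof (rule compact_operator_tendsto_zero[OF sY T])
      show "norm (w N - x N) \<le> 2" for N
        using norm_triangle_ineq4[of "w N" "x N"] w(1)[of N] x(1)[of N] by linarith
      show "(\<lambda>N. coord n (w N - x N)) \<longlonglongrightarrow> 0" for n
        by (rule Lim_null_comparison[OF _ LIMSEQ_inverse_real_of_nat])
          (use w(2) in \<open>auto simp: eventually_sequentially coord_diff intro!: exI[of _ "Suc n"]\<close>)
    qed
    then have "\<forall>\<^sub>F N in sequentially. dist (blinfun_apply T (w N - x N)) 0 < e / 2"
      by (rule tendstoD[OF _ half_gt_zero[OF e]])
    then have "\<forall>\<^sub>F N in sequentially. norm (blinfun_apply T (w N - x N)) < e / 2"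
      by (simp only: dist_norm diff_zero)
    then obtain N where N: "norm (blinfun_apply T (w N - x N)) < e / 2"
      using eventually_happens'[OF sequentially_bot] by blast
    have "norm (blinfun_apply T (x N) - U N (x N))
        \<le> norm (blinfun_apply T (w N) - U N (x N)) + norm (blinfun_apply T (w N - x N))"
      using norm_triangle_ineq4[of "blinfun_apply T (w N) - U N (x N)" "blinfun_apply T (w N - x N)"]
      by (simp add: blinfun.diff_right)
    then show False using N w(3)[of N] x(2)[of N] by linarith
  qed
  then show thesis using that unfolding U_def by blast
qed

definition coord_operator :: "('k \<Rightarrow> 'b::real_normed_vector \<Rightarrow> 'b) \<Rightarrow> nat set \<Rightarrow> (nat \<Rightarrow> 'b) \<Rightarrow> ('a \<Rightarrow>\<^sub>L 'b)" where
  "coord_operator sY A y = Blinfun (\<lambda>x. combination sY A y (\<lambda>i. coord i x))"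

lemma coord_operator_apply:
  fixes sY :: "'k \<Rightarrow> 'b::real_normed_vector \<Rightarrow> 'b"
  assumes "normed_space_over sY"
  shows "blinfun_apply (coord_operator sY A y) x = combination sY A y (\<lambda>i. coord i x)"
proof -
  interpret Y: normed_space_over sY by fact
  have "bounded_linear (coord i)" for i
    unfolding coord_def by (rule blinfun.bounded_linear_right)
  then have "bounded_linear (\<lambda>x. combination sY A y (\<lambda>i. coord i x))"
    unfolding combination_def
    by (intro bounded_linear_sum bounded_linear_compose[OF Y.bounded_linear_scale_left])
  then show ?thesis by (simp add: coord_operator_def bounded_linear_Blinfun_apply)
qed

lemma coord_unit_sequence: "norm x \<le> 1 \<Longrightarrow> (\<lambda>i. coord i x) \<in> unit_sequences"
  unfolding unit_sequences_def using norm_coord_le order_trans by blast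

lemma coord_operator_compact:
  fixes sY :: "'k \<Rightarrow> 'b::real_normed_vector \<Rightarrow> 'b"
  assumes sY: "normed_space_over sY"
  shows "coord_operator sY A y \<in> compact_operators sX sY"
proof -
  interpret Y: normed_space_over sY by fact
  have "coord_operator sY A y \<in> bounded_operators sX sY"
    unfolding bounded_operators_def Vector_Spaces.linear_iff
    using vector_space_axioms Y.vector_space_axioms
    by (simp add: blinfun.add_right coord_operator_apply[OF sY] coord_scale Y.combination_scale)
  moreover have cpt: "compact (combination sY A y ` unit_sequences)"
    by (intro compact_continuous_image Y.continuous_on_combination compact_unit_sequences)
  have "blinfun_apply (coord_operator sY A y) ` cball 0 1 \<subseteq> combination sY A y ` unit_sequences"
    using coord_unit_sequence by (auto simp: coord_operator_apply[OF sY])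
  then have "closure (blinfun_apply (coord_operator sY A y) ` cball 0 1) \<subseteq> combination sY A y ` unit_sequences"
    by (rule closure_minimal[OF _ compact_imp_closed[OF cpt]])
  then have "compact (closure (blinfun_apply (coord_operator sY A y) ` cball 0 1))"
    using compact_Int_closed[OF cpt closed_closure[of "blinfun_apply (coord_operator sY A y) ` cball 0 1"]]
    by (simp only: Int_absorb1)
  ultimately show ?thesis by (simp add: compact_operators_def)
qed

text \<open>
  The norm over the ball of \<open>X\<close> controls the norm over the ball of \<open>\<ell>\<^sub>\<infinity>\<close>, by coordinatewise
  density.
\<close>

lemma combination_le_if_operator_le:
  fixes sY :: "'k \<Rightarrow> 'b::real_normed_vector \<Rightarrow> 'b"
  assumes sY: "normed_space_over sY" and w: "w \<in> unit_sequences"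
    and le: "\<And>x. norm x \<le> 1 \<Longrightarrow> norm (combination sY A y (\<lambda>i. coord i x)) \<le> M"
  shows "norm (combination sY A y w) \<le> M"
proof -
  interpret Y: normed_space_over sY by fact
  obtain u where u: "\<And>k. norm (u k) \<le> 1" "\<And>n. (\<lambda>k. coord n (u k)) \<longlonglongrightarrow> w n"
    using ball_coord_sequence[of w] w by (auto simp: unit_sequences_def)
  have "(\<lambda>k. norm (combination sY A y (\<lambda>i. coord i (u k)))) \<longlonglongrightarrow> norm (combination sY A y w)"
    by (intro tendsto_norm Y.tendsto_combination u(2))
  then show ?thesis by (rule LIMSEQ_le_const2) (use le u(1) in auto)
qed

text \<open>
  A maximising sequence has a subsequence whose coordinates converge to some \<open>w\<close> in the ball of
  \<open>\<ell>\<^sub>\<infinity>\<close>, where the norm is attained; by uniqueness \<open>w\<close> is a rotation of the coordinates of \<open>x0\<close> on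
  \<open>A\<close>, and only these enter the value.
\<close>

lemma coord_operator_RSE:
  fixes sY :: "'k \<Rightarrow> 'b::real_normed_vector \<Rightarrow> 'b"
  assumes sY: "normed_space_over sY"
    and le: "\<And>w. w \<in> unit_sequences \<Longrightarrow> norm (combination sY A y w) \<le> 1"
    and x0: "norm x0 = 1" "norm (combination sY A y (\<lambda>i. coord i x0)) = 1"
    and uniq: "\<And>w. \<lbrakk>w \<in> unit_sequences; norm (combination sY A y w) = 1\<rbrakk>
      \<Longrightarrow> \<exists>l. norm l = 1 \<and> (\<forall>i\<in>A. w i = l * coord i x0)"
  shows "norm (coord_operator sY A y) = 1" "coord_operator sY A y \<in> RSE sX sY"
proof -
  interpret Y: normed_space_over sY by fact
  let ?S = "coord_operator sY A y"
  have ap: "blinfun_apply ?S x = combination sY A y (\<lambda>i. coord i x)" for x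
    by (rule coord_operator_apply[OF sY])
  show n: "norm ?S = 1"
  proof (rule antisym)
    show "norm ?S \<le> 1" by (rule norm_blinfun_le_on_ball) (use le coord_unit_sequence in \<open>auto simp: ap\<close>)
    show "1 \<le> norm ?S" using norm_blinfun[of ?S x0] x0 by (simp add: ap)
  qed
  have B: "?S \<in> bounded_operators sX sY"
    using coord_operator_compact[OF sY] by (auto simp: compact_operators_def)
  have "\<exists>\<sigma> l. strict_mono \<sigma> \<and> norm l = 1 \<and>
      (\<lambda>n. blinfun_apply ?S (x (\<sigma> n))) \<longlonglongrightarrow> sY l (blinfun_apply ?S x0)"
    if x: "\<And>n. norm (x n) \<le> 1" "(\<lambda>n. norm (blinfun_apply ?S (x n))) \<longlonglongrightarrow> 1" for x
  proof -
    obtain r w where w: "strict_mono r" "w \<in> unit_sequences" "\<And>n. (\<lambda>k. coord n (x (r k))) \<longlonglongrightarrow> w n"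
      using unit_sequences_subsequence[of "\<lambda>k i. coord i (x k)"] coord_unit_sequence[OF x(1)] by blast
    have lim: "(\<lambda>k. blinfun_apply ?S (x (r k))) \<longlonglongrightarrow> combination sY A y w"
      unfolding ap by (rule Y.tendsto_combination[OF w(3)])
    have "(\<lambda>k. norm (blinfun_apply ?S (x (r k)))) \<longlonglongrightarrow> 1"
      using LIMSEQ_subseq_LIMSEQ[OF x(2) w(1)] by (simp add: o_def)
    then have "norm (combination sY A y w) = 1" by (rule LIMSEQ_unique[OF tendsto_norm[OF lim]])
    then obtain l where l: "norm l = 1" "\<forall>i\<in>A. w i = l * coord i x0" using uniq w(2) by blast
    have "combination sY A y w = combination sY A y (\<lambda>i. l * coord i x0)"
      using l(2) by (simp add: combination_def)
    then have "combination sY A y w = sY l (blinfun_apply ?S x0)"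
      by (simp add: ap Y.combination_scale)
    then show ?thesis using w(1) l(1) lim by auto
  qed
  then show "?S \<in> RSE sX sY"
    unfolding RSE_def using B x0(1) n by (auto intro!: bexI[of _ x0])
qed

end


section \<open>Perturbing operators on finitely many coordinates\<close>

text \<open>
  Complex uniform convexity with the complex numbers replaced by an arbitrary scalar field. Over the
  reals only \<open>c = 1\<close> and \<open>c = -1\<close> occur.
\<close>

definition rotation_convex ::
  "('k::real_normed_field \<Rightarrow> 'b::real_normed_vector \<Rightarrow> 'b) \<Rightarrow> bool" where
  "rotation_convex sY \<longleftrightarrow>
    (\<forall>\<epsilon>>0. \<exists>\<delta>>0. \<forall>y0 y1.
      (\<forall>c. norm c = 1 \<longrightarrow> norm (y0 + sY c y1) \<le> 1) \<and> norm y1 > \<epsilon> \<longrightarrow> norm y0 < 1 - \<delta>)"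

lemma inner_one_one: "(1::'k::{real_normed_field,euclidean_space}) \<bullet> 1 = 1"
  using of_real_inner_one[of 1, where 'k = 'k] by simp

lemma eq_of_real_if_inner_one_ge:
  fixes z :: "'k::{real_normed_field,euclidean_space}"
  assumes "r \<le> z \<bullet> 1" "norm z \<le> r"
  shows "z = of_real r"
proof -
  have "0 \<le> r" using assms(2) norm_ge_zero order_trans by blast
  have "(norm (z - of_real r))\<^sup>2 = (norm z)\<^sup>2 - 2 * r * (z \<bullet> 1) + r\<^sup>2"
    unfolding power2_norm_eq_inner of_real_def
    by (simp add: inner_diff_left inner_diff_right inner_commute[of 1 z] inner_one_one power2_eq_square algebra_simps
        del: of_real_inner_one)
  moreover have "(norm z)\<^sup>2 \<le> r\<^sup>2" using assms(2) by (simp add: power_mono)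
  moreover have "r * r \<le> r * (z \<bullet> 1)" using assms(1) \<open>0 \<le> r\<close> by (rule mult_left_mono)
  ultimately have "(norm (z - of_real r))\<^sup>2 \<le> 0" by (simp add: power2_eq_square)
  then show ?thesis by simp
qed

text \<open>
  Unimodular constants are the only extremal case of the triangle inequality for sums of scalars of
  modulus at most one.
\<close>

lemma sum_in_ball_extremal:
  fixes w :: "nat \<Rightarrow> 'k::{real_normed_field,euclidean_space}"
  assumes A: "finite A" "A \<noteq> {}" and w: "\<And>i. i \<in> A \<Longrightarrow> norm (w i) \<le> 1"
    and ge: "real (card A) \<le> norm (\<Sum>i\<in>A. w i)"
  shows "\<exists>l. norm l = 1 \<and> (\<forall>i\<in>A. w i = l)"
proof -
  obtain c where c: "norm c = 1" "c * (\<Sum>i\<in>A. w i) = of_real (norm (\<Sum>i\<in>A. w i))"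
    by (rule rotate_to_norm)
  have le: "(c * w i) \<bullet> 1 \<le> 1" if "i \<in> A" for i
    using inner_one_le_norm[of "c * w i"] w[OF that] c(1) by (simp add: norm_mult)
  have "(\<Sum>i\<in>A. 1 - (c * w i) \<bullet> 1) = card A - (c * (\<Sum>i\<in>A. w i)) \<bullet> 1"
    by (simp add: sum_subtractf inner_sum_left sum_distrib_left)
  also have "\<dots> \<le> 0" using ge c(2) by simp
  finally have "(\<Sum>i\<in>A. 1 - (c * w i) \<bullet> 1) = 0"
    using le by (intro antisym sum_nonneg) auto
  then have "1 - (c * w i) \<bullet> 1 = 0" if "i \<in> A" for i
    using sum_nonneg_eq_0_iff[OF A(1), of "\<lambda>i. 1 - (c * w i) \<bullet> 1"] le that by auto
  then have "c * w i = 1" if "i \<in> A" for i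
    using eq_of_real_if_inner_one_ge[of 1 "c * w i"] that w[OF that] c(1) by (simp add: norm_mult)
  moreover have "c \<noteq> 0" using c(1) by auto
  ultimately have "w i = inverse c" if "i \<in> A" for i
    using that by (metis inverse_unique inverse_inverse_eq mult.commute)
  then show ?thesis using c(1) by (intro exI[of _ "inverse c"]) (simp add: norm_inverse)
qed

text \<open>
  The parallelogram law, in the linear form in which it is summed later.
\<close>

lemma norm_one_plus_le:
  fixes w :: "'k::{real_normed_field,euclidean_space}"
  assumes "norm w \<le> 1" "e \<le> norm (w - 1)" "0 \<le> e" "e \<le> 1"
  shows "norm (1 + w) \<le> 2 - e\<^sup>2 / 4"
proof (rule power2_le_imp_le)
  have "(norm (1 + w))\<^sup>2 + (norm (w - 1))\<^sup>2 = 2 + 2 * (norm w)\<^sup>2"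
    unfolding power2_norm_eq_inner
    by (simp add: inner_diff_left inner_diff_right inner_add_left inner_add_right inner_one_one)
  moreover have "(norm w)\<^sup>2 \<le> 1" using assms(1) by (simp add: power_le_one)
  moreover have "e\<^sup>2 \<le> (norm (w - 1))\<^sup>2" using assms(2,3) by (simp add: power_mono)
  ultimately have "(norm (1 + w))\<^sup>2 \<le> 4 - e\<^sup>2" by linarith
  also have "\<dots> \<le> (2 - e\<^sup>2 / 4)\<^sup>2"
    by (simp add: power2_diff power_divide)
  finally show "(norm (1 + w))\<^sup>2 \<le> (2 - e\<^sup>2 / 4)\<^sup>2" .
  have "e\<^sup>2 \<le> 1" using assms(3,4) by (simp add: power_le_one)
  then show "0 \<le> 2 - e\<^sup>2 / 4" by simp
qed

context normed_space_over
begin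

lemma combination_subset:
  assumes "finite A" "B \<subseteq> A"
  shows "combination scale A y (\<lambda>i. if i \<in> B then w i else 0) = combination scale B y w"
proof -
  have "(\<Sum>i\<in>A. scale (if i \<in> B then w i else 0) (y i)) = (\<Sum>i\<in>B. scale (if i \<in> B then w i else 0) (y i))"
    by (rule sum.mono_neutral_right[OF assms]) auto
  then show ?thesis by (simp add: combination_def)
qed

lemma combination_split:
  assumes "finite A" "B \<subseteq> A"
  shows "combination scale A y w = combination scale B y w + combination scale (A - B) y w"
  unfolding combination_def by (metis add.commute assms sum.subset_diff)

lemma combination_vectors_scale:
  "combination scale A (\<lambda>i. scale (c i) (y i)) w = combination scale A y (\<lambda>i. w i * c i)"
  by (simp add: combination_def)

lemma combination_subset_bound:
  assumes "finite A" "B \<subseteq> A" "\<And>w. w \<in> unit_sequences \<Longrightarrow> norm (combination scale A y w) \<le> M"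
    and "w \<in> unit_sequences"
  shows "norm (combination scale B y w) \<le> M"
proof -
  have "(\<lambda>i. if i \<in> B then w i else 0) \<in> unit_sequences"
    using assms(4) by (auto simp: unit_sequences_def)
  then show ?thesis using assms(3) combination_subset[OF assms(1,2)] by metis
qed

lemma combination_bound_scaled:
  assumes M: "\<And>w. w \<in> unit_sequences \<Longrightarrow> norm (combination scale A y w) \<le> M"
    and w: "\<And>i. i \<in> A \<Longrightarrow> norm (w i) \<le> r" and r: "0 < r"
  shows "norm (combination scale A y w) \<le> r * M"
proof -
  define v where "v i = (if i \<in> A then w i / of_real r else 0)" for i
  have "v \<in> unit_sequences" using w r by (auto simp: unit_sequences_def v_def norm_divide)
  moreover have "combination scale A y w = scale (of_real r) (combination scale A y v)"
    using r by (subst combination_scale[symmetric]) (simp add: combination_def v_def)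
  ultimately show ?thesis using M r by (simp add: norm_scale)
qed

text \<open>
  On \<open>B\<close> the sequence \<open>v\<close> leaves room for a perturbation of size \<open>s\<close> within the unit ball. So
  \<open>rot\<close> applies to the value at \<open>v\<close> and to \<open>s\<close> times the value of any sequence supported in \<open>B\<close>.
\<close>

lemma combination_small_off_peak:
  assumes rot: "\<And>y0 y1. \<lbrakk>\<forall>c. norm c = 1 \<longrightarrow> norm (y0 + scale c y1) \<le> 1; norm y1 > \<epsilon>\<rbrakk> \<Longrightarrow> norm y0 < 1 - \<delta>"
    and A: "finite A" "B \<subseteq> A"
    and M: "\<And>w. w \<in> unit_sequences \<Longrightarrow> norm (combination scale A y w) \<le> 1"
    and v: "v \<in> unit_sequences" "\<And>i. i \<in> B \<Longrightarrow> norm (v i) \<le> 1 - s" and s: "0 < s"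
    and large: "1 - \<delta> \<le> norm (combination scale A y v)" and w: "w \<in> unit_sequences"
  shows "norm (combination scale B y w) \<le> \<epsilon> / s"
proof -
  let ?y1 = "scale (of_real s) (combination scale B y w)"
  have "norm (combination scale A y v + scale c ?y1) \<le> 1" if c: "norm c = 1" for c
  proof -
    have "combination scale A y v + scale c ?y1
        = combination scale A y (\<lambda>i. v i + (if i \<in> B then c * of_real s * w i else 0))"
      unfolding combination_add combination_subset[OF A] combination_scale by simp
    moreover have "norm (v i + (if i \<in> B then c * of_real s * w i else 0)) \<le> 1" for i
    proof (cases "i \<in> B")
      case True
      have "norm (c * of_real s * w i) \<le> s"
        using c s w by (simp add: norm_mult unit_sequences_def mult_left_le)
      then show ?thesis using True v(2)[OF True] norm_triangle_ineq[of "v i" "c * of_real s * w i"] by simp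
    next
      case False
      then show ?thesis using v(1) by (simp add: unit_sequences_def)
    qed
    ultimately show ?thesis using M by (simp add: unit_sequences_def)
  qed
  then have "\<not> norm ?y1 > \<epsilon>" using rot[of "combination scale A y v" ?y1] large by force
  then show ?thesis using s by (simp add: norm_scale pos_le_divide_eq mult.commute)
qed

end

text \<open>
  A normed space over the real or complex scalars, in which the values of the combinations lie.
\<close>

locale target_space = normed_space_over sY
  for sY :: "'k::{real_normed_field,euclidean_space} \<Rightarrow> 'b::real_normed_vector \<Rightarrow> 'b"
begin

lemma combination_attains:
  obtains w where "w \<in> unit_sequences"
    "\<And>v. v \<in> unit_sequences \<Longrightarrow> norm (combination sY A y v) \<le> norm (combination sY A y w)"
proof -
  have "continuous_on unit_sequences (\<lambda>w. norm (combination sY A y w))"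
    by (intro continuous_on_norm continuous_on_combination)
  moreover have "(\<lambda>_. 0) \<in> (unit_sequences :: (nat \<Rightarrow> 'k) set)" by (simp add: unit_sequences_def)
  ultimately show thesis
    using continuous_attains_sup[OF compact_unit_sequences, of "\<lambda>w. norm (combination sY A y w)"] that by blast
qed

lemma combination_add_rank_one:
  "combination sY A (\<lambda>i. y i + sY (a i) u) w = combination sY A y w + sY (\<Sum>i\<in>A. a i * w i) u"
  by (simp add: combination_def scale_right_distrib sum.distrib scale_sum_left mult.commute)

text \<open>
  The rank one term added to \<open>t\<close> has size at most \<open>\<epsilon>\<close>. It favours sequences \<open>w\<close> with \<open>\<Sum>a\<^sub>i w\<^sub>i\<close>
  close to one, so a maximiser \<open>w\<close>, suitably rotated, is close to one outside a set \<open>B\<close> that is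
  negligible for the weights \<open>\<bar>a\<^sub>i\<bar>\<close>. The norming functional then shows that removing \<open>B\<close> from the
  constant \<open>1\<close> hardly changes the norm of the value, and \<open>combination_small_off_peak\<close> makes the
  operator small on \<open>B\<close>. Therefore multiplication by \<open>w\<close>, which moves the maximum from \<open>w\<close> to the
  constant \<open>1\<close>, is a small change of the operator.
\<close>

lemma perturb_to_attain_at_one:
  assumes rot: "rotation_convex sY" and eps: "0 < \<epsilon>" "\<epsilon> < 1"
  obtains \<gamma> where "0 < \<gamma>" and
    "\<And>A t. \<lbrakk>finite A; \<And>w. w \<in> unit_sequences \<Longrightarrow> norm (combination sY A t w) \<le> 1;
        1 - \<gamma> < norm (combination sY A t (\<lambda>_. 1))\<rbrakk> \<Longrightarrow>
      \<exists>t'. (\<forall>w\<in>unit_sequences. norm (combination sY A t' w) \<le> norm (combination sY A t' (\<lambda>_. 1))) \<and>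
        norm (combination sY A t' (\<lambda>_. 1)) \<le> 1 + \<epsilon> \<and>
        (\<forall>w\<in>unit_sequences. norm (combination sY A t' w - combination sY A t w) \<le> 7 * \<epsilon>)"
proof -
  obtain \<delta> where d: "0 < \<delta>" and rot': "\<And>y0 y1. \<lbrakk>\<forall>c. norm c = 1 \<longrightarrow> norm (y0 + sY c y1) \<le> 1; norm y1 > \<epsilon>\<rbrakk>
      \<Longrightarrow> norm y0 < 1 - \<delta>"
    using rot eps(1) unfolding rotation_convex_def by metis
  \<comment> \<open>Chosen so that \<open>\<gamma> + b = \<gamma> K\<close> for the bound \<open>b\<close> on the weight of \<open>B\<close> obtained below.\<close>
  define K where "K = 1 + 4 * (3 + 1 / \<epsilon>) / \<epsilon>\<^sup>2"
  have K: "0 < K" unfolding K_def using eps by (intro add_pos_nonneg) auto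
  define \<gamma> where "\<gamma> = min (1/2) (\<delta> / K)"
  have g: "0 < \<gamma>" "\<gamma> \<le> 1/2" "\<gamma> * K \<le> \<delta>"
  proof -
    show "0 < \<gamma>" using d K by (simp add: \<gamma>_def)
    show "\<gamma> \<le> 1/2" unfolding \<gamma>_def by (rule min.cobounded1)
    have "\<gamma> \<le> \<delta> / K" by (simp add: \<gamma>_def)
    then show "\<gamma> * K \<le> \<delta>" using K by (simp add: pos_le_divide_eq)
  qed
  show thesis
  proof (rule that[OF g(1)])
    fix A :: "nat set" and t :: "nat \<Rightarrow> 'b"
    assume A: "finite A" and bd: "\<And>w. w \<in> unit_sequences \<Longrightarrow> norm (combination sY A t w) \<le> 1"
      and large: "1 - \<gamma> < norm (combination sY A t (\<lambda>_. 1))"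
    define u where "u = combination sY A t (\<lambda>_. 1)"
    define \<rho> where "\<rho> = norm u"
    have one: "(\<lambda>_. 1) \<in> (unit_sequences :: (nat \<Rightarrow> 'k) set)" by (simp add: unit_sequences_def)
    have rho: "1 - \<gamma> < \<rho>" "\<rho> \<le> 1" using large bd[OF one] by (auto simp: \<rho>_def u_def)
    obtain g where g': "g \<in> bounded_operators sY (*)" "norm g \<le> 1" "norm u \<le> blinfun_apply g u \<bullet> 1"
      using norming_functional[OF normed_space_over_axioms] by blast
    have gle: "norm (blinfun_apply g y) \<le> norm y" for y
      using norm_blinfun[of g y] mult_right_mono[OF g'(2) norm_ge_zero[of y]] by simp
    have gu: "blinfun_apply g u = of_real \<rho>"
      using g'(3) gle[of u] by (intro eq_of_real_if_inner_one_ge) (auto simp: \<rho>_def)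
    define a where "a i = blinfun_apply g (t i)" for i
    have gcomb: "blinfun_apply g (combination sY B t w) = (\<Sum>i\<in>B. a i * w i)" for B w
      using g'(1) mem_dual_iff[OF normed_space_over_axioms]
      by (simp add: combination_def blinfun.sum_right a_def mult.commute)
    have asum: "(\<Sum>i\<in>A. a i) = of_real \<rho>" using gcomb[of A "\<lambda>_. 1"] gu by (simp add: u_def)
    have anorm: "(\<Sum>i\<in>A. norm (a i)) \<le> 1"
    proof -
      have "\<exists>l. norm l = 1 \<and> l * a i = of_real (norm (a i))" for i by (rule rotate_to_norm[of "a i"]) blast
      then obtain l where l: "\<And>i. norm (l i) = 1" "\<And>i. l i * a i = of_real (norm (a i))" by metis
      have "of_real (\<Sum>i\<in>A. norm (a i)) = blinfun_apply g (combination sY A t l)"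
        by (simp add: gcomb l(2) mult.commute[of _ "l _"])
      then have "norm (of_real (\<Sum>i\<in>A. norm (a i)) :: 'k) \<le> norm (combination sY A t l)" using gle by metis
      also have "\<dots> \<le> 1" by (rule bd) (simp add: unit_sequences_def l(1))
      finally show ?thesis unfolding norm_of_real by (rule order_trans[OF abs_ge_self])
    qed
    have nu_le: "norm (\<Sum>i\<in>B. a i * w i) \<le> r" if "B \<subseteq> A" "\<And>i. norm (w i) \<le> r" "0 \<le> r" for B w r
    proof -
      have "norm (\<Sum>i\<in>B. a i * w i) \<le> (\<Sum>i\<in>B. norm (a i) * r)"
        by (rule sum_norm_le) (simp add: norm_mult mult_left_mono that(2))
      also have "\<dots> \<le> (\<Sum>i\<in>A. norm (a i)) * r"
        unfolding sum_distrib_right by (rule sum_mono2[OF A that(1)]) (simp add: that(3))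
      also have "\<dots> \<le> r" using mult_right_mono[OF anorm that(3)] by simp
      finally show ?thesis .
    qed
    \<comment> \<open>The combination of \<open>t1\<close> is that of \<open>t\<close> plus \<open>\<epsilon>\<close> times the rank one map \<open>w \<mapsto> (\<Sum>i\<in>A. a i * w i) u\<close>.\<close>
    define t1 where "t1 i = t i + sY (of_real \<epsilon> * a i) u" for i
    have t1: "combination sY B t1 w = combination sY B t w + sY (of_real \<epsilon> * (\<Sum>i\<in>B. a i * w i)) u" for B w
      unfolding t1_def combination_add_rank_one by (simp add: sum_distrib_left mult.assoc)
    have t1_norm: "norm (combination sY A t1 w) \<le> 1 + \<epsilon> * norm (\<Sum>i\<in>A. a i * w i)" if "w \<in> unit_sequences" for w
    proof -
      have "norm (combination sY A t1 w) \<le> norm (combination sY A t w) + \<epsilon> * norm (\<Sum>i\<in>A. a i * w i) * \<rho>"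
        unfolding t1 using norm_triangle_ineq[of "combination sY A t w" "sY (of_real \<epsilon> * (\<Sum>i\<in>A. a i * w i)) u"] eps
        by (simp add: norm_scale norm_mult \<rho>_def)
      also have "\<epsilon> * norm (\<Sum>i\<in>A. a i * w i) * \<rho> \<le> \<epsilon> * norm (\<Sum>i\<in>A. a i * w i)"
        using rho eps by (intro mult_left_le) auto
      finally show ?thesis using bd[OF that] by linarith
    qed
    obtain w0 where w0: "w0 \<in> unit_sequences"
      "\<And>v. v \<in> unit_sequences \<Longrightarrow> norm (combination sY A t1 v) \<le> norm (combination sY A t1 w0)"
      using combination_attains by blast
    obtain l where l: "norm l = 1" "l * (\<Sum>i\<in>A. a i * w0 i) = of_real (norm (\<Sum>i\<in>A. a i * w0 i))"
      by (rule rotate_to_norm)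
    define w where "w i = l * w0 i" for i
    have wQ: "w \<in> unit_sequences" using w0(1) l(1) by (simp add: unit_sequences_def w_def norm_mult)
    have "combination sY A t1 w = sY l (combination sY A t1 w0)"
      unfolding w_def by (rule combination_scale)
    then have wmax: "norm (combination sY A t1 v) \<le> norm (combination sY A t1 w)" if "v \<in> unit_sequences" for v
      using w0(2)[OF that] l(1) by (simp add: norm_scale)
    define s where "s = norm (\<Sum>i\<in>A. a i * w0 i)"
    have nu_w: "(\<Sum>i\<in>A. a i * w i) = of_real s"
      using l(2) by (simp add: w_def s_def sum_distrib_left mult.left_commute)
    define \<mu> where "\<mu> = norm (combination sY A t1 w)"
    have s1: "s \<le> 1" using nu_le[of A w0 1] w0(1) by (simp add: s_def unit_sequences_def)
    have s0: "0 \<le> s" by (simp add: s_def)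
    have mu_le: "\<mu> \<le> 1 + \<epsilon> * s" using t1_norm[OF wQ] s0 by (simp add: nu_w \<mu>_def)
    have mu_ge: "\<rho> * (1 + \<epsilon> * \<rho>) \<le> \<mu>"
    proof -
      have "combination sY A t1 (\<lambda>_. 1) = sY (1 + of_real \<epsilon> * of_real \<rho>) u"
        using asum by (simp add: t1 u_def[symmetric] scale_left_distrib)
      then have "norm (combination sY A t1 (\<lambda>_. 1)) = norm (of_real (1 + \<epsilon> * \<rho>) :: 'k) * \<rho>"
        by (simp add: norm_scale \<rho>_def)
      also have "\<dots> = (1 + \<epsilon> * \<rho>) * \<rho>"
        unfolding norm_of_real using eps rho g by simp
      finally show ?thesis using wmax[OF one] by (simp add: \<mu>_def mult.commute)
    qed
    have mu: "\<mu> \<le> 1 + \<epsilon>" using mu_le s1 eps mult_left_le[of s \<epsilon>] by linarith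
    \<comment> \<open>The value at the constant \<open>1\<close> is a lower bound for the maximum, so the rank one term is almost maximal at \<open>w\<close>.\<close>
    have s_ge: "1 - 2 * \<gamma> - \<gamma> / \<epsilon> \<le> s"
    proof -
      have "(1 - \<gamma>) * (1 - \<gamma>) \<le> \<rho> * \<rho>" using rho g by (intro mult_mono) auto
      moreover have "1 - 2 * \<gamma> \<le> (1 - \<gamma>) * (1 - \<gamma>)" by (simp add: algebra_simps)
      ultimately have "1 - 2 * \<gamma> \<le> \<rho> * \<rho>" by linarith
      then have "\<epsilon> * (1 - 2 * \<gamma>) \<le> \<epsilon> * (\<rho> * \<rho>)" using eps by simp
      also have "\<dots> \<le> 1 + \<epsilon> * s - \<rho>" using mu_ge mu_le by (simp add: algebra_simps)
      also have "\<dots> \<le> \<epsilon> * s + \<gamma>" using rho by simp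
      finally have "\<epsilon> * (1 - 2 * \<gamma> - \<gamma> / \<epsilon>) \<le> \<epsilon> * s" using eps by (simp add: algebra_simps)
      then show ?thesis using eps by simp
    qed
    define B where "B = {i\<in>A. \<epsilon> < norm (w i - 1)}"
    have BA: "B \<subseteq> A" by (auto simp: B_def)
    define b where "b = (\<Sum>i\<in>B. norm (a i))"
    \<comment> \<open>Both \<open>\<Sum>a\<^sub>i\<close> and \<open>\<Sum>a\<^sub>i w\<^sub>i\<close> are almost one, and each index in \<open>B\<close> loses a fixed proportion of its weight.\<close>
    have "(\<Sum>i\<in>A. (a i * (1 + w i)) \<bullet> 1) \<le> (\<Sum>i\<in>A. 2 * norm (a i) - (if i \<in> B then \<epsilon>\<^sup>2 / 4 * norm (a i) else 0))"
    proof (rule sum_mono)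
      fix i assume i: "i \<in> A"
      have wi: "norm (w i) \<le> 1" using wQ by (simp add: unit_sequences_def)
      have "(a i * (1 + w i)) \<bullet> 1 \<le> norm (a i) * norm (1 + w i)"
        using inner_one_le_norm[of "a i * (1 + w i)"] by (simp add: norm_mult)
      also have "\<dots> \<le> norm (a i) * (2 - (if i \<in> B then \<epsilon>\<^sup>2 / 4 else 0))"
      proof (rule mult_left_mono)
        show "norm (1 + w i) \<le> 2 - (if i \<in> B then \<epsilon>\<^sup>2 / 4 else 0)"
          using norm_one_plus_le[OF wi, of \<epsilon>] eps norm_triangle_ineq[of 1 "w i"] wi by (auto simp: B_def)
      qed simp
      finally show "(a i * (1 + w i)) \<bullet> 1 \<le> 2 * norm (a i) - (if i \<in> B then \<epsilon>\<^sup>2 / 4 * norm (a i) else 0)"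
        by (simp add: algebra_simps split: if_splits)
    qed
    also have "\<dots> = 2 * (\<Sum>i\<in>A. norm (a i)) - \<epsilon>\<^sup>2 / 4 * b"
      using A BA by (simp add: sum_subtractf sum_distrib_left b_def sum.If_cases Int_absorb1)
    also have "(\<Sum>i\<in>A. (a i * (1 + w i)) \<bullet> 1) = \<rho> + s"
      using asum nu_w by (simp add: distrib_left inner_add_left sum.distrib flip: inner_sum_left)
    finally have "\<epsilon>\<^sup>2 / 4 * b \<le> 3 * \<gamma> + \<gamma> / \<epsilon>" using anorm s_ge rho by linarith
    then have "b \<le> 4 * (3 * \<gamma> + \<gamma> / \<epsilon>) / \<epsilon>\<^sup>2" using eps by (simp add: field_simps)
    also have "\<dots> = \<gamma> * K - \<gamma>" by (simp add: K_def algebra_simps)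
    finally have b: "\<gamma> + b \<le> \<delta>" using g(3) by linarith
    have tB: "norm (combination sY B t v) \<le> \<epsilon>" if "v \<in> unit_sequences" for v
    proof -
      \<comment> \<open>The constant \<open>1\<close> with the entries in \<open>B\<close> removed: it still almost attains the norm and leaves full room on \<open>B\<close>.\<close>
      define p where "p i = (if i \<in> A - B then 1 else 0 :: 'k)" for i
      have "(\<Sum>i\<in>A - B. a i) = of_real \<rho> - (\<Sum>i\<in>B. a i)"
        using asum by (simp add: sum_diff[OF A BA])
      then have "blinfun_apply g (combination sY (A - B) t (\<lambda>_. 1)) \<bullet> 1 = \<rho> - (\<Sum>i\<in>B. a i) \<bullet> 1"
        by (simp add: gcomb inner_diff_left)
      moreover have "(\<Sum>i\<in>B. a i) \<bullet> 1 \<le> b"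
        using inner_one_le_norm[of "\<Sum>i\<in>B. a i"] norm_sum[of a B] by (simp add: b_def)
      ultimately have "1 - \<delta> \<le> norm (combination sY (A - B) t (\<lambda>_. 1))"
        using b rho gle[of "combination sY (A - B) t (\<lambda>_. 1)"]
          inner_one_le_norm[of "blinfun_apply g (combination sY (A - B) t (\<lambda>_. 1))"] by linarith
      moreover have "combination sY (A - B) t (\<lambda>_. 1) = combination sY A t p"
        unfolding p_def using combination_subset[OF A, of "A - B" t "\<lambda>_. 1"] by simp
      ultimately have "1 - \<delta> \<le> norm (combination sY A t p)" by simp
      then have "norm (combination sY B t v) \<le> \<epsilon> / 1"
        by (intro combination_small_off_peak[OF rot' A BA bd, where v = p and s = 1]) (use that in \<open>auto simp: p_def unit_sequences_def\<close>)
      then show ?thesis by simp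
    qed
    \<comment> \<open>Multiplication by \<open>w\<close> moves the maximum from \<open>w\<close> to the constant \<open>1\<close>.\<close>
    define t2 where "t2 i = sY (w i) (t1 i)" for i
    have t2: "combination sY A t2 v = combination sY A t1 (\<lambda>i. v i * w i)" for v
      unfolding t2_def by (rule combination_vectors_scale)
    have t2_one: "norm (combination sY A t2 (\<lambda>_. 1)) = \<mu>" by (simp add: t2 \<mu>_def)
    have mult_Q: "(\<lambda>i. v i * w i) \<in> unit_sequences" if "v \<in> unit_sequences" for v
      using that wQ by (simp add: unit_sequences_def norm_mult mult_le_one)
    show "\<exists>t'. (\<forall>w\<in>unit_sequences. norm (combination sY A t' w) \<le> norm (combination sY A t' (\<lambda>_. 1))) \<and>
        norm (combination sY A t' (\<lambda>_. 1)) \<le> 1 + \<epsilon> \<and>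
        (\<forall>w\<in>unit_sequences. norm (combination sY A t' w - combination sY A t w) \<le> 7 * \<epsilon>)"
    proof (intro exI[of _ t2] conjI ballI)
      show "norm (combination sY A t2 (\<lambda>_. 1)) \<le> 1 + \<epsilon>" using mu t2_one by simp
      fix v :: "nat \<Rightarrow> 'k" assume v: "v \<in> unit_sequences"
      show "norm (combination sY A t2 v) \<le> norm (combination sY A t2 (\<lambda>_. 1))"
        unfolding t2_one unfolding t2 \<mu>_def by (rule wmax[OF mult_Q[OF v]])
      define h where "h i = v i * (w i - 1)" for i
      have h2: "norm (h i) \<le> 2" for i
      proof -
        have "norm (w i) \<le> 1" using wQ by (simp add: unit_sequences_def)
        then have "norm (w i - 1) \<le> 2" using norm_triangle_ineq4[of "w i" 1] unfolding norm_one by linarith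
        then show ?thesis using v mult_mono[of "norm (v i)" 1 "norm (w i - 1)" 2] by (simp add: h_def norm_mult unit_sequences_def)
      qed
      have h_off: "norm (h i) \<le> \<epsilon>" if "i \<in> A - B" for i
        using that v mult_mono[of "norm (v i)" 1 "norm (w i - 1)" \<epsilon>] eps
        by (simp add: h_def norm_mult unit_sequences_def B_def not_less)
      have split: "combination sY A t2 v - combination sY A t v
          = sY (of_real \<epsilon> * (\<Sum>i\<in>A. a i * v i)) u + (combination sY B t1 h + combination sY (A - B) t1 h)"
      proof -
        have "combination sY A t2 v - combination sY A t1 v = combination sY A t1 h"
          unfolding t2 h_def by (simp add: combination_diff[symmetric] algebra_simps)
        then show ?thesis
          using combination_split[OF A BA, of t1 h] t1[of A v] by (simp add: algebra_simps)
      qed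
      have rank: "norm (sY (of_real \<epsilon> * x) u) \<le> \<epsilon> * r" if "norm x \<le> r" for x r
        using eps rho(2) mult_mono[of "norm x" r \<rho> 1] that norm_ge_zero[of x] order_trans[OF norm_ge_zero that]
        by (simp add: norm_scale norm_mult \<rho>_def[symmetric] mult.assoc) (simp add: \<rho>_def)
      have e1: "norm (sY (of_real \<epsilon> * (\<Sum>i\<in>A. a i * v i)) u) \<le> \<epsilon> * 1"
        by (rule rank, rule nu_le) (use v in \<open>auto simp: unit_sequences_def\<close>)
      have e2: "norm (combination sY B t1 h) \<le> 2 * \<epsilon> + \<epsilon> * 2"
      proof -
        have "norm (combination sY B t h) \<le> 2 * \<epsilon>"
          by (rule combination_bound_scaled[OF tB]) (use h2 in auto)
        moreover have "norm (sY (of_real \<epsilon> * (\<Sum>i\<in>B. a i * h i)) u) \<le> \<epsilon> * 2"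
          by (rule rank, rule nu_le[OF BA]) (use h2 in auto)
        ultimately show ?thesis unfolding t1 by (rule norm_triangle_mono)
      qed
      have e3: "norm (combination sY (A - B) t1 h) \<le> \<epsilon> * (1 + \<epsilon>)"
      proof (rule combination_bound_scaled)
        show "norm (combination sY (A - B) t1 p) \<le> 1 + \<epsilon>" if "p \<in> unit_sequences" for p
        proof (rule combination_subset_bound[OF A _ _ that])
          show "norm (combination sY A t1 p) \<le> 1 + \<epsilon>" if "p \<in> unit_sequences" for p
            using wmax[OF that] mu by (simp add: \<mu>_def)
        qed auto
      qed (use h_off eps in auto)
      have "\<epsilon> * (1 + \<epsilon>) \<le> 2 * \<epsilon>" using eps by simp
      then show "norm (combination sY A t2 v - combination sY A t v) \<le> 7 * \<epsilon>"
        unfolding split using norm_triangle_mono[OF e1 norm_triangle_mono[OF e2 e3]] by linarith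
    qed
  qed
qed

text \<open>
  To an operator that attains its norm at \<open>1\<close>, with value \<open>u\<close>, a small multiple of
  \<open>w \<mapsto> (average of w) u\<close> is added. A sequence attains the new norm only if its average has modulus one,
  that is, if it is constant and unimodular on \<open>A\<close>. Dividing by the norm \<open>M\<close> completes the
  construction.
\<close>

lemma perturb_to_peak_at_one:
  assumes rot: "rotation_convex sY" and eps: "0 < \<epsilon>" "\<epsilon> < 1"
  obtains \<gamma> where "0 < \<gamma>" "\<gamma> < 1" and
    "\<And>A t. \<lbrakk>finite A; \<And>w. w \<in> unit_sequences \<Longrightarrow> norm (combination sY A t w) \<le> 1;
        1 - \<gamma> < norm (combination sY A t (\<lambda>_. 1))\<rbrakk> \<Longrightarrow>
      \<exists>t'. (\<forall>w\<in>unit_sequences. norm (combination sY A t' w) \<le> 1) \<and>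
        norm (combination sY A t' (\<lambda>_. 1)) = 1 \<and>
        (\<forall>w\<in>unit_sequences. norm (combination sY A t' w) = 1 \<longrightarrow> (\<exists>l. norm l = 1 \<and> (\<forall>i\<in>A. w i = l))) \<and>
        (\<forall>w\<in>unit_sequences. norm (combination sY A t' w - combination sY A t w) \<le> \<epsilon>)"
proof -
  \<comment> \<open>The errors below add up to \<open>17 \<kappa>\<close>.\<close>
  define \<kappa> where "\<kappa> = \<epsilon> / 32"
  have k: "0 < \<kappa>" "\<kappa> < 1" using eps by (auto simp: \<kappa>_def)
  obtain \<gamma>0 where g0: "0 < \<gamma>0" and attain:
    "\<And>A t. \<lbrakk>finite A; \<And>w. w \<in> unit_sequences \<Longrightarrow> norm (combination sY A t w) \<le> 1;
        1 - \<gamma>0 < norm (combination sY A t (\<lambda>_. 1))\<rbrakk> \<Longrightarrow>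
      \<exists>t'. (\<forall>w\<in>unit_sequences. norm (combination sY A t' w) \<le> norm (combination sY A t' (\<lambda>_. 1))) \<and>
        norm (combination sY A t' (\<lambda>_. 1)) \<le> 1 + \<kappa> \<and>
        (\<forall>w\<in>unit_sequences. norm (combination sY A t' w - combination sY A t w) \<le> 7 * \<kappa>)"
    using perturb_to_attain_at_one[OF rot k] by blast
  define \<gamma> where "\<gamma> = min \<gamma>0 \<kappa>"
  show thesis
  proof (rule that)
    show "0 < \<gamma>" "\<gamma> < 1" using g0 k by (auto simp: \<gamma>_def)
    fix A :: "nat set" and t :: "nat \<Rightarrow> 'b"
    assume A: "finite A" and bd: "\<And>w. w \<in> unit_sequences \<Longrightarrow> norm (combination sY A t w) \<le> 1"
      and large: "1 - \<gamma> < norm (combination sY A t (\<lambda>_. 1))"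
    have "1 - \<gamma>0 < norm (combination sY A t (\<lambda>_. 1))" using large by (simp add: \<gamma>_def)
    then obtain t' where t': "\<And>w. w \<in> unit_sequences \<Longrightarrow> norm (combination sY A t' w) \<le> norm (combination sY A t' (\<lambda>_. 1))"
        "norm (combination sY A t' (\<lambda>_. 1)) \<le> 1 + \<kappa>"
        "\<And>w. w \<in> unit_sequences \<Longrightarrow> norm (combination sY A t' w - combination sY A t w) \<le> 7 * \<kappa>"
      using attain[OF A bd] by blast
    define u where "u = combination sY A t' (\<lambda>_. 1)"
    define \<mu> where "\<mu> = norm u"
    have one: "(\<lambda>_. 1) \<in> (unit_sequences :: (nat \<Rightarrow> 'k) set)" by (simp add: unit_sequences_def)
    have mu: "1 - 8 * \<kappa> \<le> \<mu>" "\<mu> \<le> 1 + \<kappa>"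
      using t'(2) t'(3)[OF one] large norm_triangle_sub[of "combination sY A t (\<lambda>_. 1)" u]
      by (auto simp: \<mu>_def u_def \<gamma>_def norm_minus_commute)
    have mu0: "0 < \<mu>" using mu(1) eps by (simp add: \<kappa>_def)
    then have ne: "A \<noteq> {}" by (auto simp: \<mu>_def u_def combination_def)
    define n where "n = real (card A)"
    have n: "0 < n" using A ne by (simp add: n_def card_gt_0_iff)
    define M where "M = \<mu> * (1 + \<kappa>)"
    have M0: "0 < M" using mu0 k by (simp add: M_def)
    define z where "z w = combination sY A t' w + sY (of_real (\<kappa> / n) * (\<Sum>i\<in>A. w i)) u" for w
    define t3 where "t3 i = sY (of_real (1 / M)) (t' i + sY (of_real (\<kappa> / n)) u)" for i
    have t3: "combination sY A t3 w = sY (of_real (1 / M)) (z w)" for w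
    proof -
      have "combination sY A t3 w = sY (of_real (1 / M)) (combination sY A (\<lambda>i. t' i + sY (of_real (\<kappa> / n)) u) w)"
        unfolding t3_def combination_vectors_scale by (subst mult.commute) (rule combination_scale)
      then show ?thesis unfolding combination_add_rank_one z_def sum_distrib_left .
    qed
    have sum_le: "norm (\<Sum>i\<in>A. w i) \<le> n" if "w \<in> unit_sequences" for w :: "nat \<Rightarrow> 'k"
      using norm_sum[of w A] sum_bounded_above[of A "\<lambda>i. norm (w i)" 1] that
      by (simp add: n_def unit_sequences_def)
    have avg: "norm (sY (of_real (\<kappa> / n) * (\<Sum>i\<in>A. w i)) u) = \<kappa> * \<mu> * (norm (\<Sum>i\<in>A. w i) / n)" for w
      using n k by (simp add: norm_scale norm_mult norm_divide \<mu>_def)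
    have z_le: "norm (z w) \<le> \<mu> + \<kappa> * \<mu> * (norm (\<Sum>i\<in>A. w i) / n)" if "w \<in> unit_sequences" for w
      unfolding z_def avg[symmetric]
      using norm_triangle_mono[OF t'(1)[OF that] order_refl] by (simp add: \<mu>_def u_def)
    have avg_le: "\<kappa> * \<mu> * (norm (\<Sum>i\<in>A. w i) / n) \<le> \<kappa> * \<mu>" if "w \<in> unit_sequences" for w :: "nat \<Rightarrow> 'k"
      using sum_le[OF that] n k mu0 by (intro mult_left_le) (auto simp: pos_divide_le_eq)
    have z_M: "norm (z w) \<le> M" if "w \<in> unit_sequences" for w
      using z_le[OF that] avg_le[OF that] by (simp add: M_def algebra_simps)
    have "of_real (\<kappa> / n) * (\<Sum>i\<in>A. 1) = (of_real \<kappa> :: 'k)"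
    proof -
      have "(\<Sum>i\<in>A. 1) = (of_real n :: 'k)" by (simp add: n_def)
      then have "of_real (\<kappa> / n) * (\<Sum>i\<in>A. 1) = (of_real (\<kappa> / n * n) :: 'k)" by (simp only: of_real_mult)
      then show ?thesis using n by simp
    qed
    then have "z (\<lambda>_. 1) = sY (of_real (1 + \<kappa>)) u"
      by (simp add: z_def u_def[symmetric] scale_left_distrib)
    then have "norm (z (\<lambda>_. 1)) = norm (of_real (1 + \<kappa>) :: 'k) * \<mu>" by (simp only: norm_scale \<mu>_def)
    then have z_one: "norm (z (\<lambda>_. 1)) = M" unfolding norm_of_real using k by (simp add: M_def)
    have norm_t3: "norm (combination sY A t3 w) = norm (z w) / M" for w
      using M0 by (simp add: t3 norm_scale norm_divide)
    show "\<exists>t'. (\<forall>w\<in>unit_sequences. norm (combination sY A t' w) \<le> 1) \<and>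
        norm (combination sY A t' (\<lambda>_. 1)) = 1 \<and>
        (\<forall>w\<in>unit_sequences. norm (combination sY A t' w) = 1 \<longrightarrow> (\<exists>l. norm l = 1 \<and> (\<forall>i\<in>A. w i = l))) \<and>
        (\<forall>w\<in>unit_sequences. norm (combination sY A t' w - combination sY A t w) \<le> \<epsilon>)"
    proof (intro exI[of _ t3] conjI ballI impI)
      show "norm (combination sY A t3 (\<lambda>_. 1)) = 1" using M0 by (simp add: norm_t3 z_one)
      fix w :: "nat \<Rightarrow> 'k" assume w: "w \<in> unit_sequences"
      show "norm (combination sY A t3 w) \<le> 1" using z_M[OF w] M0 by (simp add: norm_t3)
      show "\<exists>l. norm l = 1 \<and> (\<forall>i\<in>A. w i = l)" if "norm (combination sY A t3 w) = 1"
      proof (rule sum_in_ball_extremal[OF A ne])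
        have "norm (z w) = M" using that M0 by (simp add: norm_t3)
        then have "\<kappa> * \<mu> * 1 \<le> \<kappa> * \<mu> * (norm (\<Sum>i\<in>A. w i) / n)"
          using z_le[OF w] by (simp add: M_def algebra_simps)
        moreover have "0 < \<kappa> * \<mu>" using k mu0 by simp
        ultimately have "1 \<le> norm (\<Sum>i\<in>A. w i) / n" by (simp only: mult_le_cancel_left_pos)
        then show "real (card A) \<le> norm (\<Sum>i\<in>A. w i)" using n by (simp add: pos_le_divide_eq n_def)
      qed (use w in \<open>simp add: unit_sequences_def\<close>)
      have "combination sY A t3 w - z w = sY (of_real (1 / M - 1)) (z w)"
        by (simp add: t3 scale_left_diff_distrib)
      then have "norm (combination sY A t3 w - z w) = norm (of_real (1 / M - 1) :: 'k) * norm (z w)"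
        by (simp add: norm_scale)
      also have "\<dots> \<le> \<bar>1 / M - 1\<bar> * M"
        unfolding norm_of_real by (rule mult_left_mono[OF z_M[OF w]]) simp
      also have "\<dots> = \<bar>1 - M\<bar>"
      proof -
        have "\<bar>1 / M - 1\<bar> * M = \<bar>1 / M - 1\<bar> * \<bar>M\<bar>" using M0 by simp
        also have "\<dots> = \<bar>(1 / M - 1) * M\<bar>" by (rule abs_mult[symmetric])
        also have "(1 / M - 1) * M = 1 - M" using M0 by (simp add: left_diff_distrib)
        finally show ?thesis .
      qed
      also have "\<dots> \<le> 8 * \<kappa>"
      proof -
        have "M \<le> (1 + \<kappa>) * (1 + \<kappa>)" unfolding M_def using mu k by (intro mult_right_mono) auto
        also have "\<dots> \<le> 1 + 3 * \<kappa>" using k mult_left_le[of \<kappa> \<kappa>] by (simp add: algebra_simps)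
        finally have "M \<le> 1 + 3 * \<kappa>" .
        moreover have "\<mu> \<le> M" using mu0 k by (simp add: M_def)
        ultimately show ?thesis using mu k by linarith
      qed
      finally have d1: "norm (combination sY A t3 w - z w) \<le> 8 * \<kappa>" .
      have "\<kappa> * \<mu> \<le> \<kappa> * 2" using mu k by (intro mult_left_mono) auto
      then have d2: "norm (z w - combination sY A t' w) \<le> \<kappa> * 2"
        using avg_le[OF w] unfolding z_def add_diff_cancel_left' avg by linarith
      have "combination sY A t3 w - combination sY A t w = (combination sY A t3 w - z w)
          + ((z w - combination sY A t' w) + (combination sY A t' w - combination sY A t w))" by simp
      also have "norm \<dots> \<le> 8 * \<kappa> + (\<kappa> * 2 + 7 * \<kappa>)"
        by (intro norm_triangle_mono d1 d2 t'(3) w)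
      also have "\<dots> \<le> \<epsilon>" using eps by (simp add: \<kappa>_def)
      finally show "norm (combination sY A t3 w - combination sY A t w) \<le> \<epsilon>" .
    qed
  qed
qed

text \<open>
  The coordinates of \<open>x\<close> of modulus at most \<open>1 - \<beta>\<close> are discarded, which is a small change by
  \<open>combination_small_off_peak\<close>. On the set \<open>A\<close> of the others, \<open>x\<close> is within \<open>\<beta>\<close> of its unimodular part
  \<open>z\<close>, and the change of variables \<open>w\<^sub>i \<mapsto> w\<^sub>i z\<^sub>i\<close> reduces to the case where \<open>z\<close> is the constant \<open>1\<close>.
\<close>

lemma perturb_finite_coords:
  assumes rot: "rotation_convex sY" and eps: "0 < \<epsilon>" "\<epsilon> < 1"
  obtains \<eta> where "0 < \<eta>" and
    "\<And>F y x. \<lbrakk>finite F; \<And>w. w \<in> unit_sequences \<Longrightarrow> norm (combination sY F y w) \<le> 1;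
        x \<in> unit_sequences; 1 - \<eta> < norm (combination sY F y x)\<rbrakk> \<Longrightarrow>
      \<exists>A y' z. finite A \<and> (\<forall>i. norm (z i) = 1) \<and> (\<forall>i\<in>A. norm (x i - z i) \<le> \<epsilon>) \<and>
        (\<forall>w\<in>unit_sequences. norm (combination sY A y' w) \<le> 1) \<and>
        norm (combination sY A y' z) = 1 \<and>
        (\<forall>w\<in>unit_sequences. norm (combination sY A y' w) = 1 \<longrightarrow>
          (\<exists>l. norm l = 1 \<and> (\<forall>i\<in>A. w i = l * z i))) \<and>
        (\<forall>w\<in>unit_sequences. norm (combination sY A y' w - combination sY F y w) \<le> \<epsilon>)"
proof -
  have eps2: "0 < \<epsilon> / 2" "\<epsilon> / 2 < 1" using eps by auto
  obtain \<gamma> where g: "0 < \<gamma>" "\<gamma> < 1" and peak: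
    "\<And>A t. \<lbrakk>finite A; \<And>w. w \<in> unit_sequences \<Longrightarrow> norm (combination sY A t w) \<le> 1;
        1 - \<gamma> < norm (combination sY A t (\<lambda>_. 1))\<rbrakk> \<Longrightarrow>
      \<exists>t'. (\<forall>w\<in>unit_sequences. norm (combination sY A t' w) \<le> 1) \<and>
        norm (combination sY A t' (\<lambda>_. 1)) = 1 \<and>
        (\<forall>w\<in>unit_sequences. norm (combination sY A t' w) = 1 \<longrightarrow> (\<exists>l. norm l = 1 \<and> (\<forall>i\<in>A. w i = l))) \<and>
        (\<forall>w\<in>unit_sequences. norm (combination sY A t' w - combination sY A t w) \<le> \<epsilon> / 2)"
    using perturb_to_peak_at_one[OF rot eps2] by blast
  define \<beta> where "\<beta> = min \<epsilon> (\<gamma> / 4)"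
  define r where "r = min (\<gamma> / 4) (\<epsilon> / 2)"
  have b: "0 < \<beta>" "\<beta> < 1" "\<beta> \<le> \<epsilon>" "\<beta> \<le> \<gamma> / 4" and r: "0 < r" "r \<le> \<gamma> / 4" "r \<le> \<epsilon> / 2"
    using eps g by (auto simp: \<beta>_def r_def)
  obtain \<delta> where d: "0 < \<delta>" and rot': "\<And>y0 y1. \<lbrakk>\<forall>c. norm c = 1 \<longrightarrow> norm (y0 + sY c y1) \<le> 1; norm y1 > \<beta> * r\<rbrakk>
      \<Longrightarrow> norm y0 < 1 - \<delta>"
    using rot b(1) r(1) unfolding rotation_convex_def by (metis mult_pos_pos)
  show thesis
  proof (rule that)
    show "0 < min \<delta> (\<gamma> / 4)" using d g by simp
    fix F :: "nat set" and y :: "nat \<Rightarrow> 'b" and x :: "nat \<Rightarrow> 'k"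
    assume F: "finite F" and bd: "\<And>w. w \<in> unit_sequences \<Longrightarrow> norm (combination sY F y w) \<le> 1"
      and x: "x \<in> unit_sequences" and large: "1 - min \<delta> (\<gamma> / 4) < norm (combination sY F y x)"
    define A where "A = {i\<in>F. 1 - \<beta> < norm (x i)}"
    have AF: "A \<subseteq> F" and fA: "finite A" using F by (auto simp: A_def)
    have off: "norm (combination sY (F - A) y w) \<le> r" if "w \<in> unit_sequences" for w
    proof -
      have "norm (combination sY (F - A) y w) \<le> \<beta> * r / \<beta>"
        by (rule combination_small_off_peak[OF rot' F _ bd x _ b(1)])
          (use large that in \<open>auto simp: A_def not_less\<close>)
      then show ?thesis using b(1) by simp
    qed
    define z where "z i = (if i \<in> A then x i / of_real (norm (x i)) else 1)" for i
    have xpos: "0 < norm (x i)" if "i \<in> A" for i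
      using that b(2) unfolding A_def mem_Collect_eq by linarith
    have z1: "norm (z i) = 1" for i using xpos[of i] by (auto simp: z_def norm_divide)
    have zx: "norm (x i - z i) \<le> \<beta>" if i: "i \<in> A" for i
    proof -
      have "x i = of_real (norm (x i)) * z i"
        using xpos[OF i] i by (simp add: z_def)
      then have "x i - z i = of_real (norm (x i) - 1) * z i"
        by (simp add: left_diff_distrib)
      then have "norm (x i - z i) = \<bar>norm (x i) - 1\<bar>" using z1[of i] by (simp only: norm_mult norm_of_real mult_1_right)
      moreover have "norm (x i) \<le> 1" using x by (simp add: unit_sequences_def)
      ultimately show ?thesis using i by (simp add: A_def)
    qed
    define t where "t i = sY (z i) (y i)" for i
    have t: "combination sY A t w = combination sY A y (\<lambda>i. w i * z i)" for w
      unfolding t_def by (rule combination_vectors_scale)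
    have bdA: "norm (combination sY A y w) \<le> 1" if "w \<in> unit_sequences" for w
      by (rule combination_subset_bound[OF F AF bd that])
    have rotate: "(\<lambda>i. w i * c i) \<in> unit_sequences" if "w \<in> unit_sequences" "\<And>i. norm (c i) = 1" for w c :: "nat \<Rightarrow> 'k"
      using that by (simp add: unit_sequences_def norm_mult)
    have t_large: "1 - \<gamma> < norm (combination sY A t (\<lambda>_. 1))"
    proof -
      have eq: "combination sY F y x = combination sY A t (\<lambda>_. 1)
          + (combination sY (F - A) y x + combination sY A y (\<lambda>i. x i - z i))"
        using combination_split[OF F AF, of y x] by (simp add: t combination_diff)
      have "norm (combination sY (F - A) y x + combination sY A y (\<lambda>i. x i - z i)) \<le> \<gamma> / 4 + \<beta> * 1"
        by (intro norm_triangle_mono order_trans[OF off[OF x] r(2)] combination_bound_scaled[OF bdA] zx b)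
      then show ?thesis
        using large[unfolded eq] min.cobounded2[of \<delta> "\<gamma> / 4"] b norm_triangle_ineq[of "combination sY A t (\<lambda>_. 1)"
            "combination sY (F - A) y x + combination sY A y (\<lambda>i. x i - z i)"] g by linarith
    qed
    have t_le: "norm (combination sY A t w) \<le> 1" if "w \<in> unit_sequences" for w
      unfolding t by (rule bdA[OF rotate[OF that z1]])
    obtain t' where t': "\<And>w. w \<in> unit_sequences \<Longrightarrow> norm (combination sY A t' w) \<le> 1"
        "norm (combination sY A t' (\<lambda>_. 1)) = 1"
        "\<And>w. \<lbrakk>w \<in> unit_sequences; norm (combination sY A t' w) = 1\<rbrakk> \<Longrightarrow> \<exists>l. norm l = 1 \<and> (\<forall>i\<in>A. w i = l)"
        "\<And>w. w \<in> unit_sequences \<Longrightarrow> norm (combination sY A t' w - combination sY A t w) \<le> \<epsilon> / 2"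
      using peak[OF fA t_le t_large] by blast
    define y' where "y' i = sY (inverse (z i)) (t' i)" for i
    have y': "combination sY A y' w = combination sY A t' (\<lambda>i. w i * inverse (z i))" for w
      unfolding y'_def by (rule combination_vectors_scale)
    have z0: "z i \<noteq> 0" for i using z1[of i] by auto
    have unrotate: "(\<lambda>i. w i * inverse (z i)) \<in> unit_sequences" if "w \<in> unit_sequences" for w
      by (rule rotate[OF that]) (simp add: norm_inverse z1)
    show "\<exists>A y' z. finite A \<and> (\<forall>i. norm (z i) = 1) \<and> (\<forall>i\<in>A. norm (x i - z i) \<le> \<epsilon>) \<and>
        (\<forall>w\<in>unit_sequences. norm (combination sY A y' w) \<le> 1) \<and>
        norm (combination sY A y' z) = 1 \<and>
        (\<forall>w\<in>unit_sequences. norm (combination sY A y' w) = 1 \<longrightarrow>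
          (\<exists>l. norm l = 1 \<and> (\<forall>i\<in>A. w i = l * z i))) \<and>
        (\<forall>w\<in>unit_sequences. norm (combination sY A y' w - combination sY F y w) \<le> \<epsilon>)"
    proof (intro exI[of _ A] exI[of _ y'] exI[of _ z] conjI allI ballI impI)
      show "finite A" by (rule fA)
      show "norm (z i) = 1" for i by (rule z1)
      show "norm (x i - z i) \<le> \<epsilon>" if "i \<in> A" for i using zx[OF that] b(3) by linarith
      show "norm (combination sY A y' z) = 1" using t'(2) z0 by (simp add: y')
      fix w :: "nat \<Rightarrow> 'k" assume w: "w \<in> unit_sequences"
      show "norm (combination sY A y' w) \<le> 1" unfolding y' by (rule t'(1)[OF unrotate[OF w]])
      show "\<exists>l. norm l = 1 \<and> (\<forall>i\<in>A. w i = l * z i)" if att: "norm (combination sY A y' w) = 1"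
      proof -
        obtain l where l: "norm l = 1" "\<forall>i\<in>A. w i * inverse (z i) = l"
          using t'(3)[OF unrotate[OF w]] att unfolding y' by blast
        have "w i = l * z i" if "i \<in> A" for i
        proof -
          have "w i = w i * inverse (z i) * z i" using z0 by (simp add: mult.assoc)
          then show ?thesis using l(2) that by simp
        qed
        then show ?thesis using l(1) by blast
      qed
      have "combination sY A y' w - combination sY F y w
          = (combination sY A t' (\<lambda>i. w i * inverse (z i)) - combination sY A t (\<lambda>i. w i * inverse (z i)))
            + (- combination sY (F - A) y w)"
        using combination_split[OF F AF, of y w] z0 by (simp add: y' t mult.assoc)
      also have "norm \<dots> \<le> \<epsilon> / 2 + \<epsilon> / 2"
        using off[OF w] r(3) by (intro norm_triangle_mono t'(4) unrotate w) simp
      finally show "norm (combination sY A y' w - combination sY F y w) \<le> \<epsilon>" by simp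
    qed
  qed
qed

end


section \<open>The property for compact operators\<close>

text \<open>
  The three reductions together: \<open>T\<close> is replaced by an operator on finitely many coordinates, scaled
  to be a contraction; that operator is perturbed so that it peaks exactly at the rotations of a
  unimodular \<open>z\<close> on a finite set \<open>A\<close>; and \<open>x\<close> is moved to a point of the ball with the coordinates
  \<open>z\<close> on \<open>A\<close>, where the perturbed operator attains its norm.
\<close>

theorem (in ell1_predual) BPBp_RSE_of_rotation_convex:
  fixes sY :: "'k \<Rightarrow> 'b::real_normed_vector \<Rightarrow> 'b"
  assumes sY: "normed_space_over sY" and rot: "rotation_convex sY"
  shows "has_BPBp_RSE sX sY (compact_operators sX sY)"
  unfolding has_BPBp_RSE_def
proof (intro allI impI)
  fix \<epsilon> :: real assume eps: "0 < \<epsilon>"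
  interpret Y: target_space sY by (rule target_space.intro[OF sY])
  define e where "e = min (\<epsilon> / 8) (1/2)"
  have e: "0 < e" "e < 1" "e \<le> \<epsilon> / 8" using eps by (auto simp: e_def)
  obtain \<eta>0 where eta0: "0 < \<eta>0" and perturb:
    "\<And>F y x. \<lbrakk>finite F; \<And>w. w \<in> unit_sequences \<Longrightarrow> norm (combination sY F y w) \<le> 1;
        x \<in> unit_sequences; 1 - \<eta>0 < norm (combination sY F y x)\<rbrakk> \<Longrightarrow>
      \<exists>A y' z. finite A \<and> (\<forall>i. norm (z i) = 1) \<and> (\<forall>i\<in>A. norm (x i - z i) \<le> e) \<and>
        (\<forall>w\<in>unit_sequences. norm (combination sY A y' w) \<le> 1) \<and>
        norm (combination sY A y' z) = 1 \<and>
        (\<forall>w\<in>unit_sequences. norm (combination sY A y' w) = 1 \<longrightarrow>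
          (\<exists>l. norm l = 1 \<and> (\<forall>i\<in>A. w i = l * z i))) \<and>
        (\<forall>w\<in>unit_sequences. norm (combination sY A y' w - combination sY F y w) \<le> e)"
    using Y.perturb_finite_coords[OF rot e(1,2)] by blast
  define \<eta> where "\<eta> = min (\<eta>0 / 2) (\<epsilon> / 2)"
  have eta: "0 < \<eta>" "\<eta> < \<epsilon>" "\<eta> \<le> \<eta>0 / 2" using eta0 eps by (auto simp: \<eta>_def)
  define \<tau> where "\<tau> = min (\<eta>0 / 8) e"
  have tau: "0 < \<tau>" "\<tau> \<le> \<eta>0 / 8" "\<tau> \<le> e" using eta0 e by (auto simp: \<tau>_def)
  show "\<exists>\<eta>>0. \<eta> < \<epsilon> \<and> (\<forall>T\<in>compact_operators sX sY. \<forall>x\<in>sphere 0 1.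
      norm T = 1 \<and> 1 - \<eta> < norm (blinfun_apply T x) \<longrightarrow>
      (\<exists>S\<in>RSE sX sY \<inter> compact_operators sX sY. \<exists>x0\<in>sphere 0 1.
        norm S = 1 \<and> norm (blinfun_apply S x0) = 1 \<and> norm (S - T) < \<epsilon> \<and> norm (x - x0) < \<epsilon>))"
  proof (intro exI[of _ \<eta>] conjI eta ballI impI)
    fix T x assume T: "T \<in> compact_operators sX sY" and x: "x \<in> sphere 0 1"
      and "norm T = 1 \<and> 1 - \<eta> < norm (blinfun_apply T x)"
    then have nT: "norm T = 1" and Tx: "1 - \<eta> < norm (blinfun_apply T x)" and nx: "norm x = 1" by auto
    obtain N y0 where y0: "\<And>u. norm u \<le> 1 \<Longrightarrow>
        norm (blinfun_apply T u - combination sY {..<N} y0 (\<lambda>i. coord i u)) \<le> \<tau>"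
      using compact_operator_finite_coords[OF sY T tau(1)] by blast
    \<comment> \<open>The approximation may have norm up to \<open>1 + \<tau>\<close>; it is scaled to a contraction.\<close>
    define y where "y i = sY (of_real (1 / (1 + \<tau>))) (y0 i)" for i
    have y: "combination sY {..<N} y w = sY (of_real (1 / (1 + \<tau>))) (combination sY {..<N} y0 w)" for w
      unfolding y_def Y.combination_vectors_scale by (subst mult.commute) (rule Y.combination_scale)
    have y0_ball: "norm (combination sY {..<N} y0 (\<lambda>i. coord i u)) \<le> 1 + \<tau>" if "norm u \<le> 1" for u
    proof -
      have "norm (blinfun_apply T u) \<le> 1" using norm_blinfun[of T u] nT that by simp
      then show ?thesis
        using y0[OF that] norm_triangle_sub[of "combination sY {..<N} y0 (\<lambda>i. coord i u)" "blinfun_apply T u"]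
        by (simp add: norm_minus_commute)
    qed
    have y_le: "norm (combination sY {..<N} y w) \<le> 1" if "w \<in> unit_sequences" for w
      unfolding y Y.norm_scale norm_of_real
      using combination_le_if_operator_le[OF sY that y0_ball] tau(1) by (simp add: pos_divide_le_eq)
    have y_near: "norm (combination sY {..<N} y (\<lambda>i. coord i u) - blinfun_apply T u) \<le> 2 * \<tau>"
      if u: "norm u \<le> 1" for u
    proof -
      let ?v = "combination sY {..<N} y0 (\<lambda>i. coord i u)"
      have "combination sY {..<N} y (\<lambda>i. coord i u) - ?v = sY (of_real (1 / (1 + \<tau>) - 1)) ?v"
        by (simp only: y of_real_diff of_real_1 Y.scale_left_diff_distrib Y.scale_one)
      also have "1 / (1 + \<tau>) - 1 = - (\<tau> / (1 + \<tau>))" using tau(1) by (simp add: field_simps)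
      also have "norm (sY (of_real (- (\<tau> / (1 + \<tau>)))) ?v) = \<tau> / (1 + \<tau>) * norm ?v"
        unfolding Y.norm_scale norm_of_real using tau(1) by simp
      also have "\<dots> \<le> \<tau> / (1 + \<tau>) * (1 + \<tau>)"
        using tau(1) by (intro mult_left_mono y0_ball u) simp
      also have "\<dots> = \<tau>" using tau(1) by simp
      finally have "norm ((combination sY {..<N} y (\<lambda>i. coord i u) - ?v) + (?v - blinfun_apply T u)) \<le> \<tau> + \<tau>"
        using y0[OF u] by (intro norm_triangle_mono) (simp_all add: norm_minus_commute)
      then show ?thesis by simp
    qed
    have "1 - \<eta>0 < norm (combination sY {..<N} y (\<lambda>i. coord i x))"
    proof -
      have "norm (blinfun_apply T x) \<le> norm (combination sY {..<N} y (\<lambda>i. coord i x)) + 2 * \<tau>"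
        using y_near[of x] nx norm_triangle_sub[of "blinfun_apply T x" "combination sY {..<N} y (\<lambda>i. coord i x)"]
        by (simp add: norm_minus_commute)
      then show ?thesis using Tx eta(3) tau(2) eta0 by linarith
    qed
    moreover have "(\<lambda>i. coord i x) \<in> unit_sequences" using coord_unit_sequence nx by simp
    ultimately have "\<exists>A y' z. finite A \<and> (\<forall>i. norm (z i) = 1) \<and> (\<forall>i\<in>A. norm (coord i x - z i) \<le> e) \<and>
        (\<forall>w\<in>unit_sequences. norm (combination sY A y' w) \<le> 1) \<and>
        norm (combination sY A y' z) = 1 \<and>
        (\<forall>w\<in>unit_sequences. norm (combination sY A y' w) = 1 \<longrightarrow>
          (\<exists>l. norm l = 1 \<and> (\<forall>i\<in>A. w i = l * z i))) \<and>
        (\<forall>w\<in>unit_sequences. norm (combination sY A y' w - combination sY {..<N} y w) \<le> e)"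
      by (intro perturb[OF finite_lessThan y_le])
    then obtain A y' z where A: "finite A" and "\<forall>i. norm (z i) = 1" "\<forall>i\<in>A. norm (coord i x - z i) \<le> e"
      and "\<forall>w\<in>unit_sequences. norm (combination sY A y' w) \<le> 1"
      and att: "norm (combination sY A y' z) = 1"
      and "\<forall>w\<in>unit_sequences. norm (combination sY A y' w) = 1 \<longrightarrow>
          (\<exists>l. norm l = 1 \<and> (\<forall>i\<in>A. w i = l * z i))"
      and "\<forall>w\<in>unit_sequences. norm (combination sY A y' w - combination sY {..<N} y w) \<le> e"
      by (elim exE conjE) (rule that)
    then have z: "\<And>i. norm (z i) = 1" "\<And>i. i \<in> A \<Longrightarrow> norm (coord i x - z i) \<le> e"
      and le: "\<And>w. w \<in> unit_sequences \<Longrightarrow> norm (combination sY A y' w) \<le> 1"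
      and uniq: "\<And>w. \<lbrakk>w \<in> unit_sequences; norm (combination sY A y' w) = 1\<rbrakk> \<Longrightarrow>
          \<exists>l. norm l = 1 \<and> (\<forall>i\<in>A. w i = l * z i)"
      and near: "\<And>w. w \<in> unit_sequences \<Longrightarrow> norm (combination sY A y' w - combination sY {..<N} y w) \<le> e"
      by simp_all
    obtain x0 where x0: "norm x0 \<le> 1" "\<And>i. i \<in> A \<Longrightarrow> coord i x0 = z i" "norm (x0 - x) \<le> 4 * e"
      by (rule move_coords_exactly[OF A, of z x e]) (use z nx e in auto)
    let ?S = "coord_operator sY A y'"
    have S: "blinfun_apply ?S u = combination sY A y' (\<lambda>i. coord i u)" for u
      by (rule coord_operator_apply[OF sY])
    have Sx0: "norm (combination sY A y' (\<lambda>i. coord i x0)) = 1"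
      using att x0(2) by (simp add: combination_def)
    have "norm ?S \<le> 1"
      by (rule norm_blinfun_le_on_ball) (use le coord_unit_sequence in \<open>auto simp: S\<close>)
    then have "norm (blinfun_apply ?S x0) \<le> norm x0"
      using norm_blinfun[of ?S x0] mult_right_mono[of "norm ?S" 1 "norm x0"] by simp
    then have nx0: "norm x0 = 1" using Sx0 x0(1) by (simp add: S)
    have uniq': "\<exists>l. norm l = 1 \<and> (\<forall>i\<in>A. w i = l * coord i x0)"
      if "w \<in> unit_sequences" "norm (combination sY A y' w) = 1" for w
      using uniq[OF that] x0(2) by simp
    note RSE = coord_operator_RSE[OF sY le nx0 Sx0 uniq']
    have "norm (?S - T) \<le> e + 2 * \<tau>"
    proof (rule norm_blinfun_le_on_ball)
      fix u :: 'a assume u: "norm u \<le> 1"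
      have "blinfun_apply (?S - T) u = (combination sY A y' (\<lambda>i. coord i u) - combination sY {..<N} y (\<lambda>i. coord i u))
          + (combination sY {..<N} y (\<lambda>i. coord i u) - blinfun_apply T u)"
        by (simp add: blinfun.diff_left S)
      also have "norm \<dots> \<le> e + 2 * \<tau>"
        by (intro norm_triangle_mono near coord_unit_sequence y_near u)
      finally show "norm (blinfun_apply (?S - T) u) \<le> e + 2 * \<tau>" .
    qed
    then have "norm (?S - T) < \<epsilon>" using tau(3) e eps by linarith
    moreover have "norm (x - x0) < \<epsilon>" using x0(3) e(3) eps by (simp add: norm_minus_commute)
    ultimately show "\<exists>S\<in>RSE sX sY \<inter> compact_operators sX sY. \<exists>x0\<in>sphere 0 1.
        norm S = 1 \<and> norm (blinfun_apply S x0) = 1 \<and> norm (S - T) < \<epsilon> \<and> norm (x - x0) < \<epsilon>"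
      using nx0 Sx0
      by (intro bexI[of _ ?S] bexI[of _ x0] conjI IntI RSE coord_operator_compact[OF sY]) (simp_all only: S mem_sphere_0)
  qed
qed

text \<open>
  With \<open>c = 1\<close> and \<open>c = -1\<close> the hypothesis places \<open>y0 + y1\<close> and \<open>y0 - y1\<close> in the ball, and their
  midpoint is \<open>y0\<close>. If \<open>y0\<close> is almost a unit vector, both are almost unit vectors; after
  normalisation, uniform convexity makes them close, and \<open>2 y1\<close> is their difference.
\<close>

lemma rotation_convex_if_uniformly_convex:
  fixes sY :: "'k::real_normed_field \<Rightarrow> 'b::real_normed_vector \<Rightarrow> 'b"
  assumes sY: "normed_space_over sY" and uc: "uniformly_convex TYPE('b)"
  shows "rotation_convex sY"
  unfolding rotation_convex_def
proof (intro allI impI)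
  interpret normed_space_over sY by (rule sY)
  fix \<epsilon> :: real assume eps: "0 < \<epsilon>"
  obtain d where d: "0 < d" "d < 1" and "\<forall>y1\<in>sphere (0 :: 'b) 1. \<forall>y2\<in>sphere 0 1.
      norm (y1 + y2) / 2 > 1 - d \<longrightarrow> norm (y1 - y2) < \<epsilon>"
    using uc eps unfolding uniformly_convex_def by blast
  then have close: "norm (y1 - y2) < \<epsilon>"
    if "norm y1 = 1" "norm y2 = 1" "norm (y1 + y2) / 2 > 1 - d" for y1 y2 :: 'b
    using that by simp
  define \<delta> where "\<delta> = min (d / 4) (\<epsilon> / 4)"
  have dl: "0 < \<delta>" "\<delta> \<le> d / 4" "\<delta> \<le> \<epsilon> / 4" using d eps by (auto simp: \<delta>_def)
  have normalise: "norm (a - a /\<^sub>R norm a) \<le> 2 * \<delta> \<and> norm (a /\<^sub>R norm a) = 1"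
    if "norm a \<le> 1" "1 - 2 * \<delta> \<le> norm a" for a :: 'b
  proof -
    have a0: "0 < norm a" using that(2) dl d by linarith
    have "a - a /\<^sub>R norm a = (1 - inverse (norm a)) *\<^sub>R a" by (simp add: scaleR_left_diff_distrib)
    then have "norm (a - a /\<^sub>R norm a) = \<bar>1 - inverse (norm a)\<bar> * \<bar>norm a\<bar>" by simp
    also have "\<dots> = \<bar>(1 - inverse (norm a)) * norm a\<bar>" by (rule abs_mult[symmetric])
    also have "(1 - inverse (norm a)) * norm a = norm a - 1" using a0 by (simp add: left_diff_distrib)
    finally show ?thesis using that a0 by simp
  qed
  have "norm y0 < 1 - \<delta>" if rot: "\<forall>c. norm c = 1 \<longrightarrow> norm (y0 + sY c y1) \<le> 1" and y1: "\<epsilon> < norm y1" for y0 y1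
  proof (rule ccontr)
    assume "\<not> norm y0 < 1 - \<delta>"
    then have y0: "1 - \<delta> \<le> norm y0" by simp
    define a b where "a = y0 + y1" and "b = y0 - y1"
    have ab: "norm a \<le> 1" "norm b \<le> 1"
      using rot[rule_format, of 1] rot[rule_format, of "- 1"] by (simp_all add: a_def b_def)
    have sum: "a + b = 2 *\<^sub>R y0" and diff: "a - b = 2 *\<^sub>R y1" by (simp_all add: a_def b_def scaleR_2)
    have "2 * norm y0 \<le> norm a + norm b" using norm_triangle_ineq[of a b] by (simp add: sum)
    then have low: "1 - 2 * \<delta> \<le> norm a" "1 - 2 * \<delta> \<le> norm b" using ab y0 by linarith+
    define a' b' where "a' = a /\<^sub>R norm a" and "b' = b /\<^sub>R norm b"
    have a': "norm (a - a') \<le> 2 * \<delta>" "norm a' = 1" and b': "norm (b - b') \<le> 2 * \<delta>" "norm b' = 1"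
      using normalise[OF ab(1) low(1)] normalise[OF ab(2) low(2)] by (simp_all add: a'_def b'_def)
    have "2 * norm y0 = norm ((a' + b') + ((a - a') + (b - b')))" by (simp add: sum)
    also have "\<dots> \<le> norm (a' + b') + (2 * \<delta> + 2 * \<delta>)"
      by (intro norm_triangle_mono order_refl a' b')
    finally have "norm (a' + b') / 2 > 1 - d" using y0 dl d by linarith
    then have "norm (a' - b') < \<epsilon>" using close a' b' by blast
    moreover have "2 * norm y1 = norm ((a' - b') + ((a - a') + (b' - b)))" using diff by simp
    then have "2 * norm y1 \<le> norm (a' - b') + (2 * \<delta> + 2 * \<delta>)"
      using norm_triangle_mono[OF order_refl norm_triangle_mono[OF a'(1) b'(1)[unfolded norm_minus_commute[of b]]], of "a' - b'"] by simp
    ultimately show False using y1 dl by linarith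
  qed
  then show "\<exists>\<delta>>0. \<forall>y0 y1. (\<forall>c. norm c = 1 \<longrightarrow> norm (y0 + sY c y1) \<le> 1) \<and> \<epsilon> < norm y1 \<longrightarrow> norm y0 < 1 - \<delta>"
    using dl(1) by blast
qed

lemma complex_uniformly_convex_iff_rotation_convex: "complex_uniformly_convex sY \<longleftrightarrow> rotation_convex sY"
  unfolding complex_uniformly_convex_def rotation_convex_def by (rule refl)

lemma normed_space_over_scaleR: "normed_space_over (scaleR :: real \<Rightarrow> 'a::real_normed_vector \<Rightarrow> 'a)"
  by unfold_locales (simp_all add: scaleR_add_right scaleR_add_left)

lemma ell1_predual_if_dual_isometric:
  fixes sX :: "'k::{real_normed_field,euclidean_space} \<Rightarrow> 'a::banach \<Rightarrow> 'a"
  assumes "normed_space_over sX" "dual_isometric_ell1 sX"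
  obtains \<Phi> where "ell1_predual sX \<Phi>"
proof -
  obtain \<Phi> where "bij_betw \<Phi> ell1 (bounded_operators sX (*))"
    "\<forall>a\<in>ell1. \<forall>b\<in>ell1. \<Phi> (\<lambda>n. a n + b n) = \<Phi> a + \<Phi> b"
    "\<forall>c. \<forall>a\<in>ell1. \<forall>x. blinfun_apply (\<Phi> (\<lambda>n. c * a n)) x = c * blinfun_apply (\<Phi> a) x"
    "\<forall>a\<in>ell1. norm (\<Phi> a) = (\<Sum>n. norm (a n))"
    using assms(2) unfolding dual_isometric_ell1_def by blast
  then show thesis
    by (intro that[of \<Phi>] ell1_predual.intro[OF assms(1)] ell1_predual_axioms.intro) auto
qed

theorem theorem4p10:
  fixes sX :: "complex \<Rightarrow> 'c::banach \<Rightarrow> 'c"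
    and sY :: "complex \<Rightarrow> 'd::banach \<Rightarrow> 'd"
  shows
    "(dual_isometric_ell1 (scaleR :: real \<Rightarrow> 'a::banach \<Rightarrow> 'a) \<and>
      dimension_at_least_two (scaleR :: real \<Rightarrow> 'b::banach \<Rightarrow> 'b) \<and>
      uniformly_convex TYPE('b)
      \<longrightarrow> has_BPBp_RSE (scaleR :: real \<Rightarrow> 'a \<Rightarrow> 'a) (scaleR :: real \<Rightarrow> 'b \<Rightarrow> 'b)
            (compact_operators scaleR scaleR))
     \<and>
     (normed_space_over sX \<and> normed_space_over sY \<and>
      dual_isometric_ell1 sX \<and> dimension_at_least_two sY \<and>
      (uniformly_convex TYPE('d) \<or> complex_uniformly_convex sY)
      \<longrightarrow> has_BPBp_RSE sX sY (compact_operators sX sY))"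
proof (intro conjI impI; elim conjE)
  assume dual: "dual_isometric_ell1 (scaleR :: real \<Rightarrow> 'a \<Rightarrow> 'a)" and uc: "uniformly_convex TYPE('b)"
  obtain \<Phi> where "ell1_predual (scaleR :: real \<Rightarrow> 'a \<Rightarrow> 'a) \<Phi>"
    using ell1_predual_if_dual_isometric[OF normed_space_over_scaleR dual] by blast
  then show "has_BPBp_RSE (scaleR :: real \<Rightarrow> 'a \<Rightarrow> 'a) (scaleR :: real \<Rightarrow> 'b \<Rightarrow> 'b)
      (compact_operators scaleR scaleR)"
    by (rule ell1_predual.BPBp_RSE_of_rotation_convex)
      (intro normed_space_over_scaleR rotation_convex_if_uniformly_convex uc)+
next
  assume X: "normed_space_over sX" and Y: "normed_space_over sY" and dual: "dual_isometric_ell1 sX"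
    and convex: "uniformly_convex TYPE('d) \<or> complex_uniformly_convex sY"
  have "rotation_convex sY"
    using convex rotation_convex_if_uniformly_convex[OF Y] complex_uniformly_convex_iff_rotation_convex by blast
  moreover obtain \<Phi> where "ell1_predual sX \<Phi>"
    using ell1_predual_if_dual_isometric[OF X dual] by blast
  ultimately show "has_BPBp_RSE sX sY (compact_operators sX sY)"
    using ell1_predual.BPBp_RSE_of_rotation_convex[OF _ Y] by blast
qed

end
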